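(* For all positive integers $k,t$ there exists $\ell_0$ such that for every $\ell\ge\ell_0$ the following holds: if $\mathcal{F}\subset\mathcal{U}_{k,\ell}$ is a partially $t$-intersecting family, then $|\mathcal{F}|\le|\mathcal{C}^T_{k,\ell}|$ for a $t$-element set $T\subset[k\ell]$, and equality holds only if $\mathcal{F}=\mathcal{C}^T_{k,\ell}$ for some $t$-element $T\subset[k\ell]$.
   Context: A $(k,\ell)$-partition is a partition of $[k\ell]$ into exactly $\ell$ parts, each of size $k$; $\mathcal{U}_{k,\ell}$ is the family of all $(k,\ell)$-partitions. Two partitions $P=(P_1,\ldots,P_\ell)$ and $Q=(Q_1,\ldots,Q_\ell)$ partially $t$-intersect if there are parts $P_i,Q_j$ with $|P_i\cap Q_j|\ge t$; a family is partially $t$-intersecting if any two of its members partially $t$-intersect. For a $t$-element set $T\subset[k\ell]$, $\mathcal{C}^T_{k,\ell}$ is the family of all $(k,\ell)$-partitions having a part that contains $T$ (its size does not depend on $T$). *)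

theory Defs
  imports Main "HOL-Library.Disjoint_Sets"
begin

definition kl_partitions :: "nat \<Rightarrow> nat \<Rightarrow> nat set set set" where
  "kl_partitions k l =
     {P. partition_on {1..k * l} P \<and> card P = l \<and> (\<forall>p\<in>P. card p = k)}"

definition partially_t_intersect :: "nat \<Rightarrow> nat set set \<Rightarrow> nat set set \<Rightarrow> bool" where
  "partially_t_intersect t P Q \<longleftrightarrow> (\<exists>p\<in>P. \<exists>q\<in>Q. card (p \<inter> q) \<ge> t)"

text \<open>The two members need not be distinct. For t at most k every (k,l)-partition with l positive
  partially t-intersects itself, so this matters only for t greater than k, where it makes the empty
  family the only partially t-intersecting one.\<close>

definition partially_t_intersecting :: "nat \<Rightarrow> nat set set set \<Rightarrow> bool" where
  "partially_t_intersecting t F \<longleftrightarrow> (\<forall>P\<in>F. \<forall>Q\<in>F. partially_t_intersect t P Q)"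

definition canonical_family :: "nat \<Rightarrow> nat \<Rightarrow> nat set \<Rightarrow> nat set set set" where
  "canonical_family k l T = {P \<in> kl_partitions k l. \<exists>p\<in>P. T \<subseteq> p}"

end

theory Submission
  imports Defs "HOL-Library.FuncSet" "HOL-Combinatorics.Transposition" "HOL-Real_Asymp.Real_Asymp"
begin

text \<open>The interesting range is t between 2 and k. A partition P is replaced by the set tsets t P of all
  t-sets contained in its parts, so that two partitions partially t-intersect iff these sets meet.
  Swapping two points shows that prescribing further t-sets costs a factor of order 1/l, and hence
  that at most about l^(-b) of all partitions contain b h given t-sets, where h depends only on k.

  Now let F be partially t-intersecting and R a small power of l. Up to a remainder of at most
  (l/2)^(-N) of all partitions, every member of F contains one of the sets X of boundedly many
  t-sets around which some subfamily of F is R-spread. Two such sets X, Y must meet: otherwise the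
  spread lemma of Alweiss, Lovasz, Wu and Zhang, applied to a random 2-colouring of the t-sets, finds
  two members of F that do not partially t-intersect. If the sets X have no common element, then F
  is covered by boundedly many families of partitions containing two given t-sets, and so it is too
  small. If they have a common element S, only the tiny remainder of F lies outside the canonical
  family of S. A single Q in that remainder would exclude from F all members of the canonical family
  that avoid Q, a polynomially large proportion, more than the remainder can make up for.\<close>

section \<open>The spread lemma\<close>

text \<open>B j c is the union of the first j colour classes of c. A pair (A, c) in bad is encoded by
  recolouring with the i-th colour the fragment of A: a smallest set \<phi> A' - B i c with \<phi> A' contained in
  the union of \<phi> A and B i c. The recolouring determines a canonical set V of at most 2 J elements, and
  minimality forces at least J of them to lie in \<phi> A, which is rare by spreadness.\<close>

lemma fragment_count:
  fixes \<phi> :: "'a \<Rightarrow> 'e set" and \<sigma> :: "nat \<Rightarrow> nat" and K R :: real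
  assumes fin: "finite E" "finite I"
    and sub: "\<And>A. A \<in> I \<Longrightarrow> \<phi> A \<subseteq> E"
    and spread: "\<And>Z. Z \<noteq> {} \<Longrightarrow> real (card {A\<in>I. Z \<subseteq> \<phi> A}) * R ^ card Z \<le> K"
    and R: "R \<ge> 1" and \<sigma>: "inj \<sigma>" "\<sigma> i < m" and J: "J \<ge> 1"
    and B: "\<And>j c. B j c = {e\<in>E. c e \<in> \<sigma> ` {..<j}}"
    and bad: "\<And>A c. (A, c) \<in> bad \<Longrightarrow> A \<in> I \<and> c \<in> E \<rightarrow>\<^sub>E {..<m} \<and>
        (\<exists>A'\<in>I. \<phi> A' \<subseteq> \<phi> A \<union> B i c \<and> card (\<phi> A' - B i c) \<le> 2 * J) \<and>
        (\<forall>A'\<in>I. \<phi> A' \<subseteq> \<phi> A \<union> B (Suc i) c \<longrightarrow> card (\<phi> A' - B (Suc i) c) \<ge> J)"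
  shows "real (card bad) * R ^ J \<le> real m ^ card E * (4 * real m ^ 2) ^ J * K"
proof -
  define C where "C = E \<rightarrow>\<^sub>E {..<m}"
  have finC: "finite C" unfolding C_def using fin by (intro finite_PiE) auto
  have cardC: "card C = m ^ card E" unfolding C_def using fin by (simp add: card_PiE)
  have m1: "m \<ge> 1" using \<sigma> by auto
  define fr where "fr A c = (ARG_MIN (\<lambda>A'. card (\<phi> A' - B i c)) A'. A' \<in> I \<and> \<phi> A' \<subseteq> \<phi> A \<union> B i c)" for A c
  define \<psi> where "\<psi> A c = \<phi> (fr A c) - B i c" for A c
  \<comment> \<open>\<open>vr\<close> sees only the colouring and not \<open>A\<close>, so the
    candidates for \<open>S\<close> below are determined by the recolouring alone.\<close>
  define vr where "vr c = (ARG_MIN (\<lambda>A'. card (\<phi> A' - B i c)) A'. A' \<in> I \<and> \<phi> A' \<subseteq> B (Suc i) c)" for c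
  define V where "V c = \<phi> (vr c) - B i c" for c
  \<comment> \<open>Codes: the recoloured map, a large subset \<open>S\<close> of
    \<open>V c\<close>, a member \<open>A\<close> with \<open>\<phi> A\<close> containing
    \<open>S\<close>, and the colours \<open>g\<close> that were erased on the fragment.
    \<open>dec\<close> puts \<open>g\<close> back.\<close>
  define D where "D = (SIGMA c : C. SIGMA S : {S. S \<subseteq> V c \<and> V c \<subseteq> E \<and> card (V c) \<le> 2*J \<and> card S \<ge> J}.
     SIGMA A : {A\<in>I. S \<subseteq> \<phi> A \<and> card (\<psi> A c) \<le> 2*J \<and> \<psi> A c \<subseteq> E}. \<psi> A c \<rightarrow>\<^sub>E {..<m})"
  define dec where "dec = (\<lambda>(c :: 'e \<Rightarrow> nat, S :: 'e set, A, g :: 'e \<Rightarrow> nat). (A, (\<lambda>e. if e \<in> \<psi> A c then g e else c e)))"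
  have "bad \<subseteq> dec ` D"
  proof
    fix z assume z: "z \<in> bad"
    obtain A c where zz: "z = (A, c)" by (cases z)
    note b = bad[OF z[unfolded zz]]
    have AI: "A \<in> I" and cC: "c \<in> C" using b by (auto simp: C_def)
    obtain A0 where A0: "A0 \<in> I \<and> \<phi> A0 \<subseteq> \<phi> A \<union> B i c" and A0c: "card (\<phi> A0 - B i c) \<le> 2 * J" using b by blast
    have fr: "fr A c \<in> I" "\<phi> (fr A c) \<subseteq> \<phi> A \<union> B i c" and frc: "card (\<psi> A c) \<le> 2 * J"
      using arg_min_nat_lemma[of "\<lambda>A'. A' \<in> I \<and> \<phi> A' \<subseteq> \<phi> A \<union> B i c" A0 "\<lambda>A'. card (\<phi> A' - B i c)", OF A0] A0 A0c
      unfolding fr_def \<psi>_def by (auto intro: order_trans)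
    have \<psi>A: "\<psi> A c \<subseteq> \<phi> A" using fr unfolding \<psi>_def by auto
    have \<psi>E: "\<psi> A c \<subseteq> E" using \<psi>A sub AI by auto
    define c' where "c' = (\<lambda>e. if e \<in> \<psi> A c then \<sigma> i else c e)"
    have c'C: "c' \<in> C" using cC \<psi>E \<sigma> unfolding C_def c'_def PiE_def Pi_def extensional_def by auto
    have disj: "\<psi> A c \<inter> B i c = {}" unfolding \<psi>_def by auto
    have notin: "\<sigma> i \<notin> \<sigma> ` {..<i}" using \<sigma> by (auto simp: inj_def)
    \<comment> \<open>The fragment avoids \<open>B i c\<close> and its new colour is not among the
      first \<open>i\<close>, so \<open>B i\<close> is unchanged and \<open>dec\<close> finds the
      same fragment from \<open>A\<close> and \<open>c'\<close>.\<close>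
    have Beq: "B i c' = B i c" using disj notin \<psi>E unfolding B c'_def by auto
    have \<psi>eq: "\<psi> A c' = \<psi> A c" unfolding \<psi>_def fr_def Beq ..
    have BS: "B (Suc i) c' = \<psi> A c \<union> B (Suc i) c" using \<psi>E unfolding B c'_def by (auto simp: lessThan_Suc)
    have BS2: "B i c \<subseteq> B (Suc i) c" unfolding B by auto
    have P0: "fr A c \<in> I \<and> \<phi> (fr A c) \<subseteq> B (Suc i) c'" using fr BS BS2 unfolding \<psi>_def by auto
    have vr: "vr c' \<in> I" "\<phi> (vr c') \<subseteq> B (Suc i) c'" "card (V c') \<le> card (\<psi> A c)"
      using arg_min_nat_lemma[of "\<lambda>A'. A' \<in> I \<and> \<phi> A' \<subseteq> B (Suc i) c'" "fr A c" "\<lambda>A'. card (\<phi> A' - B i c')", OF P0] P0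
      unfolding vr_def V_def \<psi>_def Beq by auto
    \<comment> \<open>\<open>B (Suc i) c'\<close> exceeds \<open>B (Suc i) c\<close> only by points
      of the fragment, so \<open>S\<close> lies in \<open>\<phi> A\<close>; the second half of
      badness, applied to \<open>vr c'\<close>, gives it at least \<open>J\<close> elements.\<close>
    define S where "S = \<phi> (vr c') - B (Suc i) c"
    have S1: "S \<subseteq> V c'" using BS2 unfolding S_def V_def Beq by auto
    have S0: "V c' \<subseteq> E" using vr(1) sub unfolding V_def by auto
    have S2: "S \<subseteq> \<psi> A c" using vr(2) BS unfolding S_def by auto
    have S3: "J \<le> card S" unfolding S_def using b vr(1,2) BS \<psi>A by blast
    have "(c', S, A, restrict c (\<psi> A c)) \<in> D"
      unfolding D_def using c'C S0 S1 S2 S3 vr(3) frc \<psi>A \<psi>E AI cC \<psi>eq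
      by (auto simp: C_def PiE_def Pi_def)
    moreover have "dec (c', S, A, restrict c (\<psi> A c)) = z"
      unfolding dec_def zz by (simp add: \<psi>eq fun_eq_iff) (simp add: c'_def)
    ultimately show "z \<in> dec ` D" by (metis image_eqI)
  qed
  have R0: "R > 0" using R by simp
  \<comment> \<open>Any singleton serves here; \<open>undefined\<close> is just some
    element.\<close>
  have K0: "K \<ge> 0" using spread[of "{undefined}"] R0 by (simp add: order_trans[rotated])
  have finS: "finite {S. S \<subseteq> V c \<and> V c \<subseteq> E \<and> card (V c) \<le> 2*J \<and> card S \<ge> J}" for c
    by (rule finite_subset[of _ "Pow E"]) (use fin in auto)
  have finP: "finite (\<psi> A c \<rightarrow>\<^sub>E {..<m})" if "\<psi> A c \<subseteq> E" for A c
    using that fin by (intro finite_PiE) (auto intro: finite_subset)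
  have finA: "finite (SIGMA A : {A\<in>I. S \<subseteq> \<phi> A \<and> card (\<psi> A c) \<le> 2*J \<and> \<psi> A c \<subseteq> E}. \<psi> A c \<rightarrow>\<^sub>E {..<m})" for S c
    using fin finP by (intro finite_SigmaI) auto
  have finD: "finite D" unfolding D_def
    using finC finS finP fin(2) by (intro finite_SigmaI) auto
  have "real (card bad) \<le> real (card D)"
    using \<open>bad \<subseteq> dec ` D\<close> finD by (meson card_image_le card_mono finite_imageI le_trans of_nat_mono)
  also have "\<dots> = (\<Sum>c\<in>C. \<Sum>S\<in>{S. S \<subseteq> V c \<and> V c \<subseteq> E \<and> card (V c) \<le> 2*J \<and> card S \<ge> J}.
      \<Sum>A\<in>{A\<in>I. S \<subseteq> \<phi> A \<and> card (\<psi> A c) \<le> 2*J \<and> \<psi> A c \<subseteq> E}. real m ^ card (\<psi> A c))"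
  proof -
    have 1: "card (\<psi> A c \<rightarrow>\<^sub>E {..<m}) = m ^ card (\<psi> A c)" if "\<psi> A c \<subseteq> E" for A c
      using that fin by (simp add: card_PiE finite_subset)
    have "card D = (\<Sum>c\<in>C. \<Sum>S\<in>{S. S \<subseteq> V c \<and> V c \<subseteq> E \<and> card (V c) \<le> 2*J \<and> card S \<ge> J}.
      \<Sum>A\<in>{A\<in>I. S \<subseteq> \<phi> A \<and> card (\<psi> A c) \<le> 2*J \<and> \<psi> A c \<subseteq> E}. card (\<psi> A c \<rightarrow>\<^sub>E {..<m}))"
      unfolding D_def using finC finS finA finP fin by (simp add: card_SigmaI)
    then show ?thesis by (simp add: 1)
  qed
  \<comment> \<open>For each recoloured map there are at most \<open>2 ^ (2*J)\<close> sets
    \<open>S\<close>; each admits at most \<open>K / R ^ J\<close> members \<open>A\<close> by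
    spreadness, and the fragment had at most \<open>m ^ (2*J)\<close> old colourings.\<close>
  also have "\<dots> \<le> (\<Sum>c\<in>C. 4 ^ J * (K / R ^ J * real m ^ (2*J)))"
  proof (rule sum_mono)
    fix c assume "c \<in> C"
    let ?\<S> = "{S. S \<subseteq> V c \<and> V c \<subseteq> E \<and> card (V c) \<le> 2*J \<and> card S \<ge> J}"
    have "(\<Sum>S\<in>?\<S>. \<Sum>A\<in>{A\<in>I. S \<subseteq> \<phi> A \<and> card (\<psi> A c) \<le> 2*J \<and> \<psi> A c \<subseteq> E}. real m ^ card (\<psi> A c))
       \<le> (\<Sum>S\<in>?\<S>. K / R ^ J * real m ^ (2*J))"
    proof (rule sum_mono)
      fix S assume S: "S \<in> ?\<S>"
      have "(\<Sum>A\<in>{A\<in>I. S \<subseteq> \<phi> A \<and> card (\<psi> A c) \<le> 2*J \<and> \<psi> A c \<subseteq> E}. real m ^ card (\<psi> A c))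
         \<le> (\<Sum>A\<in>{A\<in>I. S \<subseteq> \<phi> A \<and> card (\<psi> A c) \<le> 2*J \<and> \<psi> A c \<subseteq> E}. real m ^ (2*J))"
        using m1 by (intro sum_mono power_increasing) auto
      also have "\<dots> \<le> (\<Sum>A\<in>{A\<in>I. S \<subseteq> \<phi> A}. real m ^ (2*J))"
        using fin by (intro sum_mono2) auto
      also have "\<dots> = real (card {A\<in>I. S \<subseteq> \<phi> A}) * real m ^ (2*J)" by simp
      also have "\<dots> \<le> K / R ^ J * real m ^ (2*J)"
      proof (rule mult_right_mono)
        have "S \<noteq> {}" using S J by auto
        have "real (card {A\<in>I. S \<subseteq> \<phi> A}) * R ^ J \<le> real (card {A\<in>I. S \<subseteq> \<phi> A}) * R ^ card S"
          using S R by (intro mult_left_mono power_increasing) auto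
        also have "\<dots> \<le> K" using spread[OF \<open>S \<noteq> {}\<close>] .
        finally show "real (card {A\<in>I. S \<subseteq> \<phi> A}) \<le> K / R ^ J" using R0 by (simp add: field_simps)
      qed simp
      finally show "(\<Sum>A\<in>{A\<in>I. S \<subseteq> \<phi> A \<and> card (\<psi> A c) \<le> 2*J \<and> \<psi> A c \<subseteq> E}. real m ^ card (\<psi> A c)) \<le> K / R ^ J * real m ^ (2*J)" .
    qed
    also have "\<dots> = real (card ?\<S>) * (K / R ^ J * real m ^ (2*J))" by simp
    also have "\<dots> \<le> 4 ^ J * (K / R ^ J * real m ^ (2*J))"
    proof (rule mult_right_mono)
      show "real (card ?\<S>) \<le> 4 ^ J"
      proof (cases "card (V c) \<le> 2 * J \<and> ?\<S> \<noteq> {}")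
        case True
        then have "finite (V c)" using fin by (auto intro: finite_subset)
        then have "card ?\<S> \<le> card (Pow (V c))" by (intro card_mono) auto
        also have "\<dots> = 2 ^ card (V c)" using \<open>finite (V c)\<close> by (simp add: card_Pow)
        also have "\<dots> \<le> 2 ^ (2*J)" using True by (intro power_increasing) auto
        finally have "card ?\<S> \<le> 4 ^ J" by (simp add: power_mult)
        then show ?thesis by (metis of_nat_le_iff of_nat_numeral of_nat_power)
      next
        case False
        then have "?\<S> = {}" by auto
        then show ?thesis by (simp only:) simp
      qed
    qed (use K0 R0 in simp)
    finally show "(\<Sum>S\<in>?\<S>. \<Sum>A\<in>{A\<in>I. S \<subseteq> \<phi> A \<and> card (\<psi> A c) \<le> 2*J \<and> \<psi> A c \<subseteq> E}. real m ^ card (\<psi> A c))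
       \<le> 4 ^ J * (K / R ^ J * real m ^ (2*J))" .
  qed
  also have "\<dots> = real m ^ card E * (4 ^ J * (K / R ^ J * real m ^ (2*J)))" by (simp add: cardC)
  finally show ?thesis using R0 unfolding power_mult power_mult_distrib by (simp add: field_simps)
qed


text \<open>The first \<open>s\<close> colour classes are revealed one by one, and in each round the
  bound on the fragment of \<open>A\<close> is halved. By \<open>fragment_count\<close> a round
  fails for a proportion of at most \<open>32 * s^2 / R\<close> of the pairs \<open>(A, c)\<close>,
  all rounds together for less than 1/2. If no round fails, the fragment is empty because
  \<open>card E < 2 ^ s\<close>.\<close>

lemma spread_colouring:
  fixes \<phi> :: "'a \<Rightarrow> 'e set" and \<sigma> :: "nat \<Rightarrow> nat" and R :: real
  assumes fin: "finite E" "finite I" and I: "I \<noteq> {}"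
    and sub: "\<And>A. A \<in> I \<Longrightarrow> \<phi> A \<subseteq> E"
    and spread: "\<And>Z. Z \<noteq> {} \<Longrightarrow> real (card {A\<in>I. Z \<subseteq> \<phi> A}) * R ^ card Z \<le> 2 * real (card I)"
    and E: "card E < 2 ^ s" and s: "s \<ge> 1" and R: "R > 64 * real s ^ 3"
    and \<sigma>: "inj \<sigma>" "\<And>i. i < s \<Longrightarrow> \<sigma> i < 2 * s"
  shows "(2 * s) ^ card E < 2 * card {c \<in> E \<rightarrow>\<^sub>E {..<2*s}. \<exists>A\<in>I. \<forall>e\<in>\<phi> A. c e \<in> \<sigma> ` {..<s}}"
proof -
  define m where "m = 2 * s"
  define C where "C = E \<rightarrow>\<^sub>E {..<m}"
  have finC: "finite C" unfolding C_def using fin by (intro finite_PiE) auto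
  have cardC: "card C = m ^ card E" unfolding C_def using fin by (simp add: card_PiE)
  define B where "B j c = {e\<in>E. c e \<in> \<sigma> ` {..<j}}" for j c
  define good where "good i A c \<longleftrightarrow> (\<exists>A'\<in>I. \<phi> A' \<subseteq> \<phi> A \<union> B i c \<and> card (\<phi> A' - B i c) * 2 ^ i \<le> card E)" for i A c
  define bad where "bad i = {(A, c). A \<in> I \<and> c \<in> C \<and> good i A c \<and> \<not> good (Suc i) A c}" for i
  define W where "W = {c \<in> C. \<exists>A\<in>I. \<forall>e\<in>\<phi> A. c e \<in> \<sigma> ` {..<s}}"
  have s3: "real s ^ 3 \<ge> real s ^ 2" "real s ^ 2 \<ge> 1" using s by (auto intro: power_increasing)
  have R1: "R \<ge> 1" and R2: "4 * real m ^ 2 \<le> R" and R0: "R > 0"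
    using R s3 by (auto simp: m_def power_mult_distrib)
  have finbad: "finite (bad i)" for i
    by (rule finite_subset[of _ "I \<times> C"]) (use fin finC in \<open>auto simp: bad_def\<close>)
  have bad: "real (card (bad i)) * R \<le> real m ^ card E * (4 * real m ^ 2) * (2 * real (card I))" if i: "i < s" for i
  proof -
    \<comment> \<open>The least integer above \<open>card E / 2 ^ Suc i\<close>: a fragment too
      large for round \<open>Suc i\<close> has at least \<open>J\<close> elements, and one within
      the bound of round \<open>i\<close> has at most \<open>2 * J\<close>.\<close>
    define J where "J = card E div 2 ^ Suc i + 1"
    have "real (card (bad i)) * R ^ J \<le> real m ^ card E * (4 * real m ^ 2) ^ J * (2 * real (card I))"
    proof (rule fragment_count[OF fin, where \<phi>=\<phi> and \<sigma>=\<sigma> and i=i and B=B])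
      show "\<phi> A \<subseteq> E" if "A \<in> I" for A using sub that .
      show "real (card {A\<in>I. Z \<subseteq> \<phi> A}) * R ^ card Z \<le> 2 * real (card I)" if "Z \<noteq> {}" for Z using spread that .
      show "1 \<le> R" "inj \<sigma>" "\<sigma> i < m" "J \<ge> 1" using R1 \<sigma> i by (auto simp: J_def m_def)
      show "B j c = {e\<in>E. c e \<in> \<sigma> ` {..<j}}" for j c unfolding B_def ..
      fix A c assume "(A, c) \<in> bad i"
      then have 1: "A \<in> I" "c \<in> C" "good i A c" "\<not> good (Suc i) A c" by (auto simp: bad_def)
      have 2: "x \<le> 2 * J" if "x * 2 ^ i \<le> card E" for x
      proof -
        have "x \<le> card E div 2 ^ i" using that by (simp add: less_eq_div_iff_mult_less_eq)
        moreover have "card E div 2 ^ Suc i = card E div 2 ^ i div 2"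
          by (metis div_mult2_eq power_Suc2)
        moreover have "x \<le> a \<Longrightarrow> b = a div 2 \<Longrightarrow> x \<le> 2 * (b + 1)" for a b :: nat by presburger
        ultimately show ?thesis unfolding J_def by blast
      qed
      have 3: "J \<le> x" if "\<not> x * 2 ^ Suc i \<le> card E" for x
      proof -
        have "card E div 2 ^ Suc i < x" using that by (subst div_less_iff_less_mult) auto
        then show ?thesis unfolding J_def by simp
      qed
      show "A \<in> I \<and> c \<in> E \<rightarrow>\<^sub>E {..<m} \<and>
        (\<exists>A'\<in>I. \<phi> A' \<subseteq> \<phi> A \<union> B i c \<and> card (\<phi> A' - B i c) \<le> 2 * J) \<and>
        (\<forall>A'\<in>I. \<phi> A' \<subseteq> \<phi> A \<union> B (Suc i) c \<longrightarrow> J \<le> card (\<phi> A' - B (Suc i) c))"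
        using 1 2 3 unfolding good_def C_def by blast
    qed
    then have "real (card (bad i)) \<le> real m ^ card E * (2 * real (card I)) * (4 * real m ^ 2 / R) ^ J"
      using R0 by (simp add: field_simps power_divide)
    also have "\<dots> \<le> real m ^ card E * (2 * real (card I)) * (4 * real m ^ 2 / R) ^ 1"
      using R2 R0 by (intro mult_left_mono power_decreasing) (auto simp: J_def)
    finally show ?thesis using R0 by (simp add: field_simps)
  qed
  \<comment> \<open>\<open>good 0\<close> holds with \<open>A\<close> itself as witness, whereas
    \<open>good s\<close> would force an empty fragment and put \<open>c\<close> into
    \<open>W\<close>; hence some round fails.\<close>
  have "I \<times> (C - W) \<subseteq> (\<Union>i<s. bad i)"
  proof clarify
    fix A c assume A: "A \<in> I" and c: "c \<in> C" "c \<notin> W"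
    have g0: "good 0 A c" unfolding good_def using A sub[OF A] fin by (auto simp: B_def intro!: bexI[of _ A] card_mono)
    have gs: "\<not> good s A c"
    proof
      assume "good s A c"
      then obtain A' where A': "A' \<in> I" "card (\<phi> A' - B s c) * 2 ^ s \<le> card E" unfolding good_def by blast
      from A'(2) have "card (\<phi> A' - B s c) * 2 ^ s < 1 * 2 ^ s" using E by linarith
      then have "card (\<phi> A' - B s c) = 0"
        unfolding mult_less_cancel2 by simp
      moreover have "finite (\<phi> A' - B s c)" using sub A'(1) fin by (meson finite_Diff finite_subset)
      ultimately have "\<phi> A' \<subseteq> B s c" by auto
      then have "c \<in> W" using A' c unfolding W_def B_def by blast
      then show False using c by simp
    qed
    obtain i where "i < s" "good i A c" "\<not> good (Suc i) A c"
      using g0 gs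
    proof -
      have "\<exists>i<s. good i A c \<and> \<not> good (Suc i) A c"
      proof (rule ccontr)
        assume n: "\<not> ?thesis"
        have "j \<le> s \<Longrightarrow> good j A c" for j
          by (induction j) (use g0 n in auto)
        then show False using gs by simp
      qed
      then show ?thesis using that by blast
    qed
    then show "(A, c) \<in> (\<Union>i<s. bad i)" using A c by (auto simp: bad_def)
  qed
  then have "card (I \<times> (C - W)) \<le> card (\<Union>i<s. bad i)"
    using finbad by (intro card_mono) auto
  also have "\<dots> \<le> (\<Sum>i<s. card (bad i))" by (rule card_UN_le) simp
  finally have "real (card I) * real (card (C - W)) \<le> (\<Sum>i<s. real (card (bad i)))"
    by (metis card_cartesian_product of_nat_le_iff of_nat_mult of_nat_sum)
  also have "\<dots> \<le> (\<Sum>i<s. real m ^ card E * (4 * real m ^ 2) * (2 * real (card I)) / R)"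
    using bad R0 by (intro sum_mono) (simp add: field_simps)
  also have "\<dots> = real (card I) * (real m ^ card E * (32 * real s ^ 3 / R))"
    using R0 by (simp add: m_def field_simps power2_eq_square power3_eq_cube)
  finally have "real (card (C - W)) \<le> real m ^ card E * (32 * real s ^ 3 / R)"
    using I fin by (subst (asm) mult_le_cancel_left_pos) (simp_all add: card_gt_0_iff)
  also have "\<dots> < real m ^ card E * (1/2)"
    using R R0 s by (intro mult_strict_left_mono) (auto simp: m_def field_simps)
  finally have "real (card (C - W)) < real m ^ card E * (1/2)" .
  moreover have "card (C - W) = card C - card W" "card W \<le> card C"
    using finC by (auto simp: W_def card_Diff_subset intro: card_mono)
  ultimately have "real (card C) < 2 * real (card W)" by (simp add: cardC of_nat_diff)
  then have "card C < 2 * card W" by linarith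
  then show ?thesis unfolding cardC unfolding W_def C_def m_def .
qed

text \<open>The \<open>2 * s\<close> colours are split into halves. More than half of all colourings
  paint some member of \<open>I\<close> in lower colours only, and more than half paint some member
  of \<open>J\<close> in upper colours only; a colouring doing both separates these two
  members.\<close>

lemma cross_spread:
  fixes \<phi> :: "'a \<Rightarrow> 'e set" and \<psi> :: "'b \<Rightarrow> 'e set" and R :: real
  assumes "finite E" "card E < 2 ^ s" "s \<ge> 1" "R > 64 * real s ^ 3"
    and "finite I" "I \<noteq> {}" "\<And>A. A \<in> I \<Longrightarrow> \<phi> A \<subseteq> E"
    and "\<And>Z. Z \<noteq> {} \<Longrightarrow> real (card {A\<in>I. Z \<subseteq> \<phi> A}) * R ^ card Z \<le> 2 * real (card I)"
    and "finite J" "J \<noteq> {}" "\<And>A. A \<in> J \<Longrightarrow> \<psi> A \<subseteq> E"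
    and "\<And>Z. Z \<noteq> {} \<Longrightarrow> real (card {A\<in>J. Z \<subseteq> \<psi> A}) * R ^ card Z \<le> 2 * real (card J)"
  shows "\<exists>A\<in>I. \<exists>B\<in>J. \<phi> A \<inter> \<psi> B = {}"
proof -
  define C where "C = E \<rightarrow>\<^sub>E {..<2*s}"
  define W1 where "W1 = {c \<in> C. \<exists>A\<in>I. \<forall>e\<in>\<phi> A. c e \<in> id ` {..<s}}"
  define W2 where "W2 = {c \<in> C. \<exists>A\<in>J. \<forall>e\<in>\<psi> A. c e \<in> (+) s ` {..<s}}"
  have finC: "finite C" unfolding C_def using assms by (intro finite_PiE) auto
  have cardC: "card C = (2*s) ^ card E" unfolding C_def using assms by (simp add: card_PiE)
  have "card C < 2 * card W1" unfolding cardC unfolding W1_def C_def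
    by (rule spread_colouring[where R=R]) (use assms in auto)
  moreover have "card C < 2 * card W2" unfolding cardC unfolding W2_def C_def
    by (rule spread_colouring[where R=R]) (use assms in auto)
  moreover have "card (W1 \<union> W2) \<le> card C" using finC by (intro card_mono) (auto simp: W1_def W2_def)
  moreover have "card (W1 \<union> W2) = card W1 + card W2" if "W1 \<inter> W2 = {}"
    using that finC by (intro card_Un_disjoint) (auto simp: W1_def W2_def)
  ultimately have "W1 \<inter> W2 \<noteq> {}" by linarith
  then obtain c A B where "A \<in> I" "B \<in> J" "\<forall>e\<in>\<phi> A. c e < s" "\<forall>e\<in>\<psi> B. c e \<ge> s"
    unfolding W1_def W2_def by fastforce
  then show ?thesis by (metis disjoint_iff leD)
qed

section \<open>Switching\<close>

abbreviation inside :: "'a set set \<Rightarrow> 'a set \<Rightarrow> bool" where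
  "inside P S \<equiv> \<exists>p\<in>P. S \<subseteq> p"

lemma kl_partitionsD:
  assumes "P \<in> kl_partitions k l"
  shows "\<Union>P = {1..k * l}" "disjoint P" "card P = l" "\<And>p. p \<in> P \<Longrightarrow> card p = k"
    "\<And>p. p \<in> P \<Longrightarrow> finite p" "finite P" "\<And>p. p \<in> P \<Longrightarrow> p \<subseteq> {1..k * l}"
proof -
  show 1: "\<Union>P = {1..k * l}" "disjoint P" "card P = l" "\<And>p. p \<in> P \<Longrightarrow> card p = k"
    using assms unfolding kl_partitions_def partition_on_def by auto
  show 2: "p \<subseteq> {1..k * l}" if "p \<in> P" for p using 1(1) that by blast
  show "finite p" if "p \<in> P" for p using 2[OF that] finite_subset by blast
  show "finite P" by (rule finite_UnionD) (simp add: 1(1))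
qed

lemma finite_kl_partitions: "finite (kl_partitions k l)"
  by (rule finite_subset[OF _ finitely_many_partition_on[of "{1..k * l}"]]) (auto simp: kl_partitions_def)

lemma finite_canonical_family: "finite (canonical_family k l T)"
  using finite_kl_partitions unfolding canonical_family_def by simp

lemma kl_partitions_image:
  assumes \<pi>: "bij_betw \<pi> {1..k * l} {1..k * l}" and P: "P \<in> kl_partitions k l"
  shows "(`) \<pi> ` P \<in> kl_partitions k l"
proof -
  note D = kl_partitionsD[OF P]
  have inj: "inj_on \<pi> {1..k * l}" using \<pi> by (rule bij_betw_imp_inj_on)
  have sub: "P \<subseteq> Pow {1..k * l}" using D(7) by auto
  have "partition_on (\<pi> ` {1..k * l}) ((`) \<pi> ` P)"
  proof -
    have "partition_on {1..k * l} P" using P by (simp add: kl_partitions_def)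
    moreover from this have "(`) \<pi> ` P - {{}} = (`) \<pi> ` P" by (auto dest: partition_onD3)
    ultimately show ?thesis using partition_on_inj_image[OF _ inj, of P] by simp
  qed
  moreover have "card ((`) \<pi> ` P) = l"
    using card_image[OF inj_on_subset[OF inj_on_image_Pow[OF inj] sub]] D(3) by simp
  moreover have "card (\<pi> ` p) = k" if "p \<in> P" for p
    using D(4,7)[OF that] inj by (metis card_image inj_on_subset)
  ultimately show ?thesis using \<pi> unfolding kl_partitions_def by (auto simp: bij_betw_def)
qed

lemma inside_image: "inside P S \<Longrightarrow> inside ((`) \<pi> ` P) (\<pi> ` S)"
  by blast

definition swap_points :: "nat \<Rightarrow> nat \<Rightarrow> nat set set \<Rightarrow> nat set set" where
  "swap_points y z P = (`) (transpose y z) ` P"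

lemma swap_points_kl_partitions:
  assumes "P \<in> kl_partitions k l" "y \<in> {1..k * l}" "z \<in> {1..k * l}"
  shows "swap_points y z P \<in> kl_partitions k l"
  unfolding swap_points_def
  by (rule kl_partitions_image) (use assms in auto)

lemma swap_points_involutory [simp]: "swap_points y z (swap_points y z P) = P"
  unfolding swap_points_def by (simp add: image_image flip: image_comp)

lemma inside_swap_points:
  assumes "inside P S" "y \<notin> S" "z \<notin> S"
  shows "inside (swap_points y z P) S"
proof -
  have "transpose y z ` S = S" using assms by simp
  then show ?thesis using inside_image[OF assms(1), of "transpose y z"] unfolding swap_points_def by simp
qed

text \<open>Double counting of the pairs (P, z): the point z can be recovered from the swapped
  partition as a point of the part of x, which leaves k - 1 choices.\<close>

lemma switching_bound:
  assumes G: "G \<subseteq> kl_partitions k l" "\<And>P. P \<in> G \<Longrightarrow> inside P {x, y}"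
    and H: "H \<subseteq> kl_partitions k l" "\<And>P z. P \<in> G \<Longrightarrow> z \<in> Y \<Longrightarrow> swap_points y z P \<in> H"
    and xy: "x \<noteq> y" "x \<notin> Y" and Y: "finite Y"
  shows "card G * card Y \<le> (k - 1) * card H"
proof -
  have finH: "finite H" using H(1) finite_kl_partitions finite_subset by blast
  have finU: "finite {z. z \<noteq> x \<and> inside P {x, z}}" "card {z. z \<noteq> x \<and> inside P {x, z}} \<le> k - 1" if "P \<in> H" for P
  proof -
    note D = kl_partitionsD[OF subsetD[OF H(1) that]]
    show 1: "finite {z. z \<noteq> x \<and> inside P {x, z}}"
      by (rule finite_subset[of _ "\<Union>P"]) (use D(1) in auto)
    show "card {z. z \<noteq> x \<and> inside P {x, z}} \<le> k - 1"
    proof (cases "\<exists>p\<in>P. x \<in> p")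
      case True
      then obtain p where p: "p \<in> P" "x \<in> p" by blast
      have "{z. z \<noteq> x \<and> inside P {x, z}} \<subseteq> p - {x}"
        using D(2) p by (auto simp: disjoint_def)
      then have "card {z. z \<noteq> x \<and> inside P {x, z}} \<le> card (p - {x})"
        using D(5)[OF p(1)] by (intro card_mono) auto
      then show ?thesis using D(4,5)[OF p(1)] p(2) by simp
    next
      case False
      then have "{z. z \<noteq> x \<and> inside P {x, z}} = {}" by auto
      then show ?thesis by (simp only:) simp
    qed
  qed
  have "G \<times> Y \<subseteq> (\<lambda>(P, z). (swap_points y z P, z)) ` (SIGMA P : H. {z. z \<noteq> x \<and> inside P {x, z}})"
  proof clarify
    fix P z assume P: "P \<in> G" and z: "z \<in> Y"
    have "inside (swap_points y z P) (transpose y z ` {x, y})"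
      using inside_image[OF G(2)[OF P]] unfolding swap_points_def .
    moreover have "transpose y z ` {x, y} = {x, z}" using xy z by (auto simp: transpose_def)
    ultimately have "inside (swap_points y z P) {x, z}" by (simp only:)
    then have "(swap_points y z P, z) \<in> (SIGMA P : H. {z. z \<noteq> x \<and> inside P {x, z}})"
      using H(2)[OF P z] xy z by auto
    then show "(P, z) \<in> (\<lambda>(P, z). (swap_points y z P, z)) ` (SIGMA P : H. {z. z \<noteq> x \<and> inside P {x, z}})"
      by (rule rev_image_eqI) simp
  qed
  then have "card (G \<times> Y) \<le> card (SIGMA P : H. {z. z \<noteq> x \<and> inside P {x, z}})"
    using finH finU by (intro surj_card_le) auto
  also have "\<dots> = (\<Sum>P\<in>H. card {z. z \<noteq> x \<and> inside P {x, z}})"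
    using finH finU by (intro card_SigmaI) auto
  also have "\<dots> \<le> (\<Sum>P\<in>H. k - 1)" using finU by (intro sum_mono) auto
  finally show ?thesis by (simp add: card_cartesian_product mult.commute)
qed

section \<open>Sizes of the canonical families\<close>

lemma card_canonical_family_le:
  assumes "T \<subseteq> {1..k * l}" "S \<subseteq> {1..k * l}" "card T = card S"
  shows "card (canonical_family k l T) \<le> card (canonical_family k l S)"
proof -
  let ?N = "{1..k * l}"
  have fin: "finite T" "finite S" using assms finite_subset by blast+
  obtain f where f: "bij_betw f T S" using fin assms(3) by (metis finite_same_card_bij)
  have "card (?N - T) = card (?N - S)" using assms fin by (simp add: card_Diff_subset)
  then obtain g where g: "bij_betw g (?N - T) (?N - S)" by (metis finite_same_card_bij finite_Diff finite_atLeastAtMost)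
  \<comment> \<open>A permutation of the ground set carrying \<open>T\<close> onto \<open>S\<close>,
    glued from a bijection of these sets and one of their complements; it acts injectively on the
    partitions.\<close>
  define \<pi> where "\<pi> x = (if x \<in> T then f x else g x)" for x
  have "bij_betw \<pi> T S" using f by (rule iffD1[OF bij_betw_cong, rotated]) (auto simp: \<pi>_def)
  moreover have "bij_betw \<pi> (?N - T) (?N - S)" using g by (rule iffD1[OF bij_betw_cong, rotated]) (auto simp: \<pi>_def)
  ultimately have "bij_betw \<pi> (T \<union> (?N - T)) (S \<union> (?N - S))" by (rule bij_betw_combine) auto
  then have \<pi>: "bij_betw \<pi> ?N ?N" using assms by (simp add: Un_absorb1)
  have \<pi>T: "\<pi> ` T = S" using \<open>bij_betw \<pi> T S\<close> by (simp add: bij_betw_def)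
  have inj: "inj_on ((`) ((`) \<pi>)) (canonical_family k l T)"
  proof -
    have "inj_on ((`) ((`) \<pi>)) (Pow (Pow ?N))"
      using \<pi> by (intro inj_on_image_Pow) (auto simp: bij_betw_def)
    then show ?thesis by (rule inj_on_subset) (use kl_partitionsD(7) in \<open>fastforce simp: canonical_family_def\<close>)
  qed
  show ?thesis
  proof (rule card_inj_on_le[OF inj _ finite_canonical_family], clarify)
    fix P assume "P \<in> canonical_family k l T"
    then have "P \<in> kl_partitions k l" "inside P T" by (auto simp: canonical_family_def)
    then show "(`) \<pi> ` P \<in> canonical_family k l S"
      using kl_partitions_image[OF \<pi>] inside_image[of P T \<pi>] \<pi>T by (auto simp: canonical_family_def)
  qed
qed

lemma card_canonical_family_eq:
  assumes "T \<subseteq> {1..k * l}" "S \<subseteq> {1..k * l}" "card T = card S"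
  shows "card (canonical_family k l T) = card (canonical_family k l S)"
  using assms by (simp add: card_canonical_family_le le_antisym)

text \<open>Every part has at least \<open>t\<close> points, so the canonical families of all
  \<open>t\<close>-sets cover the partitions; there are at most \<open>(k * l) ^ t\<close> of them,
  all of the same size.\<close>

lemma card_kl_partitions_le:
  assumes T: "T \<subseteq> {1..k * l}" "card T = t" and t: "t \<le> k" and l: "l \<ge> 1"
  shows "card (kl_partitions k l) \<le> (k * l) ^ t * card (canonical_family k l T)"
proof -
  let ?\<T> = "{S. S \<subseteq> {1..k * l} \<and> card S = t}"
  have fin: "finite ?\<T>" by simp
  have "kl_partitions k l \<subseteq> (\<Union>S\<in>?\<T>. canonical_family k l S)"
  proof
    fix P assume P: "P \<in> kl_partitions k l"
    note D = kl_partitionsD[OF P]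
    obtain p where p: "p \<in> P" using D(3) l by fastforce
    obtain S where "S \<subseteq> p" "card S = t" using D(4)[OF p] t by (metis obtain_subset_with_card_n)
    then show "P \<in> (\<Union>S\<in>?\<T>. canonical_family k l S)"
      using p P D(7)[OF p] by (auto simp: canonical_family_def)
  qed
  then have "card (kl_partitions k l) \<le> card (\<Union>S\<in>?\<T>. canonical_family k l S)"
    using fin finite_canonical_family by (intro card_mono) auto
  also have "\<dots> \<le> (\<Sum>S\<in>?\<T>. card (canonical_family k l S))" by (rule card_UN_le[OF fin])
  also have "\<dots> = (\<Sum>S\<in>?\<T>. card (canonical_family k l T))"
    using T by (intro sum.cong refl card_canonical_family_eq) auto
  also have "\<dots> = ((k * l) choose t) * card (canonical_family k l T)" by (simp add: n_subsets)
  also have "\<dots> \<le> (k * l) ^ t * card (canonical_family k l T)"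
    by (intro mult_right_mono) (cases "t \<le> k * l", auto simp: binomial_le_pow binomial_eq_0)
  finally show ?thesis .
qed

text \<open>Switching is applied to a point \<open>y\<close> of \<open>S\<close> outside
  \<open>T\<close> and a second point \<open>x\<close> of \<open>S\<close>: swapping
  \<open>y\<close> with a point outside \<open>T\<close> keeps \<open>T\<close> inside a part, and
  at least \<open>l\<close> such points differ from \<open>x\<close>.\<close>

lemma card_two_sets_le:
  assumes S: "S \<noteq> T" "card S = card T" "finite T" "finite S" "card T \<ge> 2" "S \<subseteq> {1..k * l}" "T \<subseteq> {1..k * l}"
    and kl: "k \<ge> 2" "l \<ge> card T + 1"
  shows "card {P \<in> canonical_family k l T. inside P S} * l \<le> k * card (canonical_family k l T)"
proof -
  obtain y where y: "y \<in> S" "y \<notin> T" using S by (metis card_subset_eq subsetI)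
  have "card (S - {y}) \<noteq> 0" using y S by simp
  then obtain x where x: "x \<in> S" "x \<noteq> y" by (metis Diff_empty Diff_insert0 all_not_in_conv card.empty DiffE insertI1)
  define Y where "Y = {1..k * l} - insert x T"
  have "card (insert x T) \<le> card T + 1" using S by (simp add: card_insert_if)
  then have "card Y \<ge> k * l - (card T + 1)" unfolding Y_def
    using diff_card_le_card_Diff[of "insert x T" "{1..k * l}"] S by simp
  moreover have "k * l \<ge> 2 * l" using kl by simp
  ultimately have Yl: "card Y \<ge> l" using kl by linarith
  have "card {P \<in> canonical_family k l T. inside P S} * card Y \<le> (k - 1) * card (canonical_family k l T)"
  proof (rule switching_bound[where x=x and y=y])
    show "inside P {x, y}" if "P \<in> {P \<in> canonical_family k l T. inside P S}" for P
      using that x y by blast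
    show "swap_points y z P \<in> canonical_family k l T"
      if "P \<in> {P \<in> canonical_family k l T. inside P S}" "z \<in> Y" for P z
      using that y S(6) inside_swap_points[of P T y z] swap_points_kl_partitions[of P k l y z]
      by (auto simp: canonical_family_def Y_def)
  qed (use x y in \<open>auto simp: canonical_family_def Y_def\<close>)
  moreover have "card {P \<in> canonical_family k l T. inside P S} * l \<le> card {P \<in> canonical_family k l T. inside P S} * card Y"
    using Yl by simp
  moreover have "(k - 1) * card (canonical_family k l T) \<le> k * card (canonical_family k l T)" by simp
  ultimately show ?thesis by linarith
qed

section \<open>The t-sets contained in the parts\<close>

definition tsets :: "nat \<Rightarrow> nat set set \<Rightarrow> nat set set" where
  "tsets t P = {S. card S = t \<and> inside P S}"

lemma tsets_subset:
  "P \<in> kl_partitions k l \<Longrightarrow> tsets t P \<subseteq> {S. S \<subseteq> {1..k * l} \<and> card S = t}"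
  unfolding tsets_def using kl_partitionsD(7) by blast

lemma finite_tsets: "P \<in> kl_partitions k l \<Longrightarrow> finite (tsets t P)"
  by (rule finite_subset[OF tsets_subset]) auto

lemma partially_t_intersect_iff:
  assumes "P \<in> kl_partitions k l"
  shows "partially_t_intersect t P Q \<longleftrightarrow> tsets t P \<inter> tsets t Q \<noteq> {}"
proof
  assume "partially_t_intersect t P Q"
  then obtain p q where pq: "p \<in> P" "q \<in> Q" "t \<le> card (p \<inter> q)" unfolding partially_t_intersect_def by blast
  obtain S where "S \<subseteq> p \<inter> q" "card S = t" using pq(3) by (metis obtain_subset_with_card_n)
  then show "tsets t P \<inter> tsets t Q \<noteq> {}" using pq unfolding tsets_def by blast
next
  assume "tsets t P \<inter> tsets t Q \<noteq> {}"
  then obtain S p q where S: "card S = t" "p \<in> P" "q \<in> Q" "S \<subseteq> p" "S \<subseteq> q" unfolding tsets_def by blast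
  then have "t \<le> card (p \<inter> q)" using kl_partitionsD(5)[OF assms] by (metis card_mono finite_Int le_inf_iff)
  then show "partially_t_intersect t P Q" using S unfolding partially_t_intersect_def by blast
qed

section \<open>Counting the partitions that contain prescribed \<open>t\<close>-sets\<close>

lemma card_inside_le:
  assumes P: "P \<in> kl_partitions k l" and \<B>: "\<B> \<subseteq> P" and Z: "\<And>S. S \<in> Z \<Longrightarrow> inside \<B> S"
  shows "card Z \<le> card \<B> * 2 ^ k"
proof -
  note D = kl_partitionsD[OF P]
  have fin: "finite \<B>" using D(6) \<B> finite_subset by blast
  have "card Z \<le> card (\<Union>p\<in>\<B>. Pow p)"
    using Z D(5) \<B> fin by (intro card_mono) auto
  also have "\<dots> \<le> (\<Sum>p\<in>\<B>. card (Pow p))" by (rule card_UN_le[OF fin])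
  also have "\<dots> = (\<Sum>p\<in>\<B>. 2 ^ k)" using D(4,5) \<B> by (intro sum.cong) (auto simp: card_Pow)
  finally show ?thesis by simp
qed

text \<open>Induction on the pairs: \<open>y i\<close> is switched with points avoiding
  \<open>x i\<close> and all other pairs, so the other pairs stay together. At least half of the
  ground set is available, so each pair costs a factor \<open>2 * k / (k * l)\<close>.\<close>

lemma card_pairs_le:
  fixes x y :: "'i \<Rightarrow> nat"
  assumes "finite A" "4 * card A \<le> k * l + 2"
    and "\<And>i. i \<in> A \<Longrightarrow> x i \<noteq> y i \<and> x i \<in> {1..k * l} \<and> y i \<in> {1..k * l}"
    and "\<And>i j. i \<in> A \<Longrightarrow> j \<in> A \<Longrightarrow> i \<noteq> j \<Longrightarrow> {x i, y i} \<inter> {x j, y j} = {}"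
  shows "card {P \<in> kl_partitions k l. \<forall>i\<in>A. inside P {x i, y i}} * (k * l) ^ card A
    \<le> (2 * k) ^ card A * card (kl_partitions k l)"
  using assms
proof (induction A rule: finite_induct)
  case empty
  then show ?case by simp
next
  case (insert i A)
  let ?G = "{P \<in> kl_partitions k l. \<forall>j\<in>insert i A. inside P {x j, y j}}"
  let ?H = "{P \<in> kl_partitions k l. \<forall>j\<in>A. inside P {x j, y j}}"
  have IH: "card ?H * (k * l) ^ card A \<le> (2 * k) ^ card A * card (kl_partitions k l)"
    using insert by auto
  \<comment> \<open>\<open>y i\<close> itself stays in \<open>Y\<close>, where the swap is the
    identity. So at most \<open>1 + 2 * card A\<close> points are excluded, which by the bound with
    its summand 2 is at most half of \<open>k * l\<close>.\<close>
  define W where "W = insert (x i) (\<Union>j\<in>A. {x j, y j})"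
  define Y where "Y = {1..k * l} - W"
  have "card (\<Union>j\<in>A. {x j, y j}) \<le> (\<Sum>j\<in>A. card {x j, y j})" using insert.hyps by (intro card_UN_le)
  also have "\<dots> \<le> (\<Sum>j\<in>A. 2)" by (intro sum_mono) (auto simp: card_insert_if)
  finally have "card W \<le> 1 + 2 * card A" using insert.hyps unfolding W_def by (simp add: card_insert_if)
  moreover have "finite W" using insert.hyps unfolding W_def by auto
  then have "card Y \<ge> k * l - card W" unfolding Y_def
    using diff_card_le_card_Diff[of W "{1..k * l}"] by simp
  moreover have "4 * (card A + 1) \<le> k * l + 2" using insert by simp
  moreover have "w \<le> 1 + 2 * c \<Longrightarrow> n - w \<le> m \<Longrightarrow> 4 * (c + 1) \<le> n + 2 \<Longrightarrow> n \<le> 2 * m" for w c n m :: nat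
    by presburger
  ultimately have Y: "k * l \<le> 2 * card Y" by blast
  have "card ?G * card Y \<le> (k - 1) * card ?H"
  proof (rule switching_bound[where x="x i" and y="y i"])
    fix P z assume P: "P \<in> ?G" and z: "z \<in> Y"
    have "inside (swap_points (y i) z P) {x j, y j}" if j: "j \<in> A" for j
    proof (rule inside_swap_points)
      show "inside P {x j, y j}" using P j by blast
      show "y i \<notin> {x j, y j}" using insert.prems(3)[of i j] insert.hyps(2) j by (cases "i = j") auto
      show "z \<notin> {x j, y j}" using z j unfolding Y_def W_def by auto
    qed
    then show "swap_points (y i) z P \<in> ?H"
      using swap_points_kl_partitions[of P k l "y i" z] P z insert.prems(2)[of i] by (auto simp: Y_def)
  qed (use insert.prems(2)[of i] in \<open>auto simp: Y_def W_def\<close>)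
  then have "card ?G * (2 * card Y) \<le> 2 * k * card ?H"
proof -
    have "(k - 1) * card ?H \<le> k * card ?H" by simp
    with \<open>card ?G * card Y \<le> (k - 1) * card ?H\<close> show ?thesis by linarith
  qed
  then have "card ?G * (k * l) \<le> 2 * k * card ?H"
    using Y by (meson le_trans mult_le_mono2)
  then have "card ?G * (k * l) * (k * l) ^ card A \<le> 2 * k * card ?H * (k * l) ^ card A"
    by (rule mult_le_mono1)
  also have "\<dots> \<le> 2 * k * ((2 * k) ^ card A * card (kl_partitions k l))"
    using IH by (simp only: mult.assoc) simp
  finally show ?case using insert.hyps by (simp add: mult.assoc)
qed

text \<open>If \<open>Z\<close> occurs in some \<open>P0\<close>, its members occupy at least
  \<open>card Z / 2 ^ k\<close> parts of \<open>P0\<close>. Each of these contains two points of a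
  member of \<open>Z\<close>, and pairs from different parts are disjoint, so
  \<open>card_pairs_le\<close> yields a factor \<open>2 / l\<close> for each pair used.\<close>

lemma card_superfamily_le:
  assumes t: "t \<ge> 2" and k: "k \<ge> 2" 
  shows "\<exists>b. card Z \<le> 2 ^ (k + 1) * b \<and>
    card {P \<in> kl_partitions k l. Z \<subseteq> tsets t P} * l ^ b \<le> 2 ^ b * card (kl_partitions k l)"
proof (cases "{P \<in> kl_partitions k l. Z \<subseteq> tsets t P} = {}")
  case True
  show ?thesis unfolding True by (rule exI[of _ "card Z"]) simp
next
  case False
  then obtain P0 where P0: "P0 \<in> kl_partitions k l" "Z \<subseteq> tsets t P0" by blast
  note D = kl_partitionsD[OF P0(1)]
  define \<B> where "\<B> = {p \<in> P0. \<exists>S\<in>Z. S \<subseteq> p}"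
  have fin: "finite \<B>" "card \<B> \<le> l" 
  proof -
    have "\<B> \<subseteq> P0" unfolding \<B>_def by blast
    then show "finite \<B>" "card \<B> \<le> l" using D(3,6) finite_subset card_mono by metis+
  qed
  have Z: "card Z \<le> card \<B> * 2 ^ k"
  proof (rule card_inside_le[OF P0(1)])
    show "inside \<B> S" if S: "S \<in> Z" for S
    proof -
      obtain p where "p \<in> P0" "S \<subseteq> p" using P0(2) S unfolding tsets_def by blast
      then show ?thesis using S unfolding \<B>_def by blast
    qed
    show "\<B> \<subseteq> P0" unfolding \<B>_def by blast
  qed
  \<comment> \<open>Only half of the parts are used, to respect the bound on \<open>card A\<close>
    in \<open>card_pairs_le\<close>; rounding up keeps \<open>card \<B> \<le> 2 * b\<close>.\<close>
  define b where "b = (card \<B> + 1) div 2"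
  have "b \<le> card \<B>" unfolding b_def by linarith
  then obtain A where A: "A \<subseteq> \<B>" "card A = b" by (metis obtain_subset_with_card_n)
  have "\<exists>x y S. S \<in> Z \<and> x \<in> S \<and> y \<in> S \<and> S \<subseteq> p \<and> x \<noteq> y" if p: "p \<in> \<B>" for p
  proof -
    obtain S where S: "S \<in> Z" "S \<subseteq> p" using p \<B>_def by blast
    then have "card S \<ge> 2" using P0(2) t by (auto simp: tsets_def)
    then have "\<not> card S \<le> Suc 0" by simp
    moreover have "finite S" using \<open>card S \<ge> 2\<close> card.infinite by fastforce
    ultimately show ?thesis using S by (metis card_le_Suc0_iff_eq)
  qed
  then obtain x y S where xy: "\<And>p. p \<in> \<B> \<Longrightarrow> S p \<in> Z \<and> x p \<in> S p \<and> y p \<in> S p \<and> S p \<subseteq> p \<and> x p \<noteq> y p"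
    by metis
  have AP: "p \<in> P0" if "p \<in> A" for p using that A \<B>_def by blast
  have "card {P \<in> kl_partitions k l. \<forall>p\<in>A. inside P {x p, y p}} * (k * l) ^ card A
    \<le> (2 * k) ^ card A * card (kl_partitions k l)"
  proof (rule card_pairs_le)
    show "finite A" using A fin finite_subset by blast
    have "2 * l \<le> k * l" using k by simp
    then show "4 * card A \<le> k * l + 2" using fin(2) unfolding A b_def by linarith
    show "x p \<noteq> y p \<and> x p \<in> {1..k * l} \<and> y p \<in> {1..k * l}" if "p \<in> A" for p
    proof -
      have "S p \<subseteq> {1..k * l}" using xy[of p] A(1) D(7)[OF AP[OF that]] that by blast
      then show ?thesis using xy[of p] A(1) that by blast
    qed
    show "{x p, y p} \<inter> {x p', y p'} = {}" if "p \<in> A" "p' \<in> A" "p \<noteq> p'" for p p'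
    proof -
      have "p \<inter> p' = {}" using D(2) AP that by (auto simp: disjoint_def)
      moreover have "{x p, y p} \<subseteq> p" using xy[of p] A(1) that(1) by blast
      moreover have "{x p', y p'} \<subseteq> p'" using xy[of p'] A(1) that(2) by blast
      ultimately show ?thesis by (metis Int_mono subset_empty)
    qed
  qed
  moreover have "card {P \<in> kl_partitions k l. Z \<subseteq> tsets t P} \<le> card {P \<in> kl_partitions k l. \<forall>p\<in>A. inside P {x p, y p}}"
  proof (rule card_mono)
    show "finite {P \<in> kl_partitions k l. \<forall>p\<in>A. inside P {x p, y p}}" using finite_kl_partitions by simp
    show "{P \<in> kl_partitions k l. Z \<subseteq> tsets t P} \<subseteq> {P \<in> kl_partitions k l. \<forall>p\<in>A. inside P {x p, y p}}"
    proof clarify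
      fix P p assume "Z \<subseteq> tsets t P" "p \<in> A"
      then have "inside P (S p)" "{x p, y p} \<subseteq> S p" using xy[of p] A by (auto simp: tsets_def)
      then show "inside P {x p, y p}" by blast
    qed
  qed
  ultimately have "card {P \<in> kl_partitions k l. Z \<subseteq> tsets t P} * (k * l) ^ b
      \<le> (2 * k) ^ b * card (kl_partitions k l)"
    unfolding A by (meson le_trans mult_le_mono1)
  then have "k ^ b * (card {P \<in> kl_partitions k l. Z \<subseteq> tsets t P} * l ^ b)
      \<le> k ^ b * (2 ^ b * card (kl_partitions k l))"
    by (simp add: power_mult_distrib mult_ac)
  then have "card {P \<in> kl_partitions k l. Z \<subseteq> tsets t P} * l ^ b \<le> 2 ^ b * card (kl_partitions k l)"
    using k by simp
  moreover have "card Z \<le> 2 ^ (k + 1) * b"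
  proof -
    have "card \<B> \<le> 2 * b" unfolding b_def by linarith
    then have "card \<B> * 2 ^ k \<le> 2 * b * 2 ^ k" by (rule mult_le_mono1)
    with Z have "card Z \<le> 2 * b * 2 ^ k" by (rule order_trans)
    then show ?thesis by (simp add: mult_ac)
  qed
  ultimately show ?thesis by blast
qed

section \<open>Members of a canonical family that avoid a given partition\<close>

text \<open>A common \<open>t\<close>-set \<open>S\<close> in parts \<open>p\<close> and
  \<open>q\<close> is destroyed by swapping a point \<open>y\<close> of \<open>S\<close> outside
  \<open>T\<close> with a point \<open>z\<close> outside \<open>T\<close>, outside the parts of
  \<open>Q\<close> that meet \<open>p\<close> and outside the parts of \<open>P\<close> that meet
  \<open>q\<close>. A new common \<open>t\<close>-set would contain \<open>y\<close> or
  \<open>z\<close> and, as \<open>t \<ge> 2\<close>, a second point, which would make the old part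
  of \<open>z\<close> meet \<open>q\<close> or the part of \<open>z\<close> in \<open>Q\<close> meet
  \<open>p\<close>.\<close>

lemma swap_reduces_intersection:
  assumes P: "P \<in> kl_partitions k l" "inside P T" and Q: "Q \<in> kl_partitions k l" "\<not> inside Q T"
    and T: "finite T" "card T = t" "t \<ge> 2" and ne: "tsets t P \<inter> tsets t Q \<noteq> {}"
    and large: "k * l > 2 * k * k + t"
  shows "\<exists>y\<in>{1..k * l}. \<exists>z\<in>{1..k * l}. inside (swap_points y z P) T \<and>
    card (tsets t (swap_points y z P) \<inter> tsets t Q) < card (tsets t P \<inter> tsets t Q)"
proof -
  note DP = kl_partitionsD[OF P(1)] and DQ = kl_partitionsD[OF Q(1)]
  obtain S p q where S: "card S = t" "p \<in> P" "S \<subseteq> p" "q \<in> Q" "S \<subseteq> q"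
    using ne unfolding tsets_def by blast
  have "S \<noteq> T" using S Q(2) by blast
  then obtain y where y: "y \<in> S" "y \<notin> T" using S(1) T by (metis card_subset_eq subsetI)
  \<comment> \<open>The \<open>k\<close> points of \<open>p'\<close> meet at most \<open>k\<close>
    parts, each of size \<open>k\<close>.\<close>
  have touching: "card (\<Union>{q'\<in>Q'. q' \<inter> p' \<noteq> {}}) \<le> k * k"
    if Q': "Q' \<in> kl_partitions k l" and p': "finite p'" "card p' = k" "p' \<subseteq> {1..k * l}" for Q' p'
  proof -
    note D = kl_partitionsD[OF Q']
    define part where "part x = (THE q'. q' \<in> Q' \<and> x \<in> q')" for x
    have part: "part x = q'" if "q' \<in> Q'" "x \<in> q'" for x q'
      unfolding part_def using that D(2) by (intro the_equality) (auto simp: disjoint_def)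
    have 0: "{q'\<in>Q'. q' \<inter> p' \<noteq> {}} \<subseteq> part ` p'" using part by force
    have 1: "card {q'\<in>Q'. q' \<inter> p' \<noteq> {}} \<le> k"
      using surj_card_le[OF p'(1) 0] p'(2) by simp
    have "card (\<Union>{q'\<in>Q'. q' \<inter> p' \<noteq> {}}) \<le> (\<Sum>q'\<in>{q'\<in>Q'. q' \<inter> p' \<noteq> {}}. card q')"
      by (rule card_Union_le_sum_card)
    also have "\<dots> = (\<Sum>q'\<in>{q'\<in>Q'. q' \<inter> p' \<noteq> {}}. k)" using D(4) by (intro sum.cong) auto
    also have "\<dots> \<le> k * k" using 1 by simp
    finally show ?thesis .
  qed
  define X where "X = \<Union>{q'\<in>Q. q' \<inter> p \<noteq> {}} \<union> \<Union>{p'\<in>P. p' \<inter> q \<noteq> {}} \<union> T"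
  have "card X \<le> card (\<Union>{q'\<in>Q. q' \<inter> p \<noteq> {}}) + card (\<Union>{p'\<in>P. p' \<inter> q \<noteq> {}}) + card T"
    unfolding X_def by (meson add_le_mono1 card_Un_le le_trans)
  also have "\<dots> \<le> k * k + k * k + t"
    using touching[OF Q(1), of p] touching[OF P(1), of q] DP(4,5,7)[OF S(2)] DQ(4,5,7)[OF S(4)] T(2)
    by (intro add_mono) auto
  finally have "card X < card {1..k * l}" using large by simp
  moreover have "X \<subseteq> {1..k * l}" using DP(1) DQ(1) P(2) unfolding X_def by blast
  ultimately obtain z where z: "z \<in> {1..k * l}" "z \<notin> X"
    by (metis less_irrefl subsetI subset_antisym)
  have z1: False if "q' \<in> Q" "q' \<inter> p \<noteq> {}" "z \<in> q'" for q' using z that unfolding X_def by blast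
  have z2: False if "p' \<in> P" "p' \<inter> q \<noteq> {}" "z \<in> p'" for p' using z that unfolding X_def by blast
  have z3: "z \<notin> T" using z unfolding X_def by blast
  have yN: "y \<in> {1..k * l}" using y(1) S(3) DP(7)[OF S(2)] by blast
  have yp: "y \<in> p" "y \<in> q" using y S by auto
  let ?\<tau> = "transpose y z"
  have "tsets t (swap_points y z P) \<inter> tsets t Q \<subseteq> (tsets t P \<inter> tsets t Q) - {S}"
  proof
    fix S' assume S': "S' \<in> tsets t (swap_points y z P) \<inter> tsets t Q"
    then obtain p' q' where pq: "p' \<in> P" "S' \<subseteq> ?\<tau> ` p'" "q' \<in> Q" "S' \<subseteq> q'" "card S' = t"
      unfolding tsets_def swap_points_def by blast
    have preim: "?\<tau> w \<in> p'" if "w \<in> S'" for w using pq(2) that by (auto simp: transpose_involutory)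
    have other: "\<exists>w\<in>S'. w \<noteq> v" for v
    proof (rule ccontr)
      assume "\<not> ?thesis"
      then have "S' \<subseteq> {v}" by blast
      then have "card S' \<le> card {v}" by (intro card_mono) auto
      then show False using pq(5) T(3) by simp
    qed
    have ynot: "y \<notin> S'"
    proof
      assume yS: "y \<in> S'"
      then have "q' = q" using pq(3,4) S(4) yp DQ(2) by (auto simp: disjoint_def)
      obtain w where w: "w \<in> S'" "w \<noteq> y" using other by blast
      have zp: "z \<in> p'" using preim[OF yS] by simp
      have "w \<in> q" using w pq(4) \<open>q' = q\<close> by blast
      moreover have "w \<in> p'" using preim[OF w(1)] w(2) zp by (cases "w = z") auto
      ultimately show False using z2[OF pq(1) _ zp] by blast
    qed
    have znot: "z \<notin> S'"
    proof
      assume zS: "z \<in> S'"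
      then have "y \<in> p'" using preim[OF zS] by simp
      then have "p' = p" using pq(1) S(2) yp DP(2) by (auto simp: disjoint_def)
      obtain w where w: "w \<in> S'" "w \<noteq> z" using other by blast
      then have "w \<noteq> y" using ynot by blast
      then have "w \<in> p" using preim[OF w(1)] w(2) \<open>p' = p\<close> by simp
      moreover have "w \<in> q'" "z \<in> q'" using w(1) zS pq(4) by auto
      ultimately show False using z1[OF pq(3)] by blast
    qed
    have "S' \<subseteq> p'" 
    proof
      fix w assume "w \<in> S'"
      then show "w \<in> p'" using preim[of w] ynot znot by (metis transpose_apply_other)
    qed
    then show "S' \<in> (tsets t P \<inter> tsets t Q) - {S}" using pq y(1) ynot unfolding tsets_def by blast
  qed
  moreover have "finite (tsets t P \<inter> tsets t Q)" using finite_tsets[OF P(1)] by simp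
  moreover have "S \<in> tsets t P \<inter> tsets t Q" using S unfolding tsets_def by blast
  ultimately have "card (tsets t (swap_points y z P) \<inter> tsets t Q) < card (tsets t P \<inter> tsets t Q)"
    by (intro psubset_card_mono) blast+
  then show ?thesis using yN z inside_swap_points[OF P(2) y(2) z3] by blast
qed

text \<open>By Markov's inequality a positive proportion of the canonical family has at most M t-sets in
  common with Q. Repairing such a partition takes at most M swaps, each of which can be undone in at
  most (k l)^2 ways.\<close>

lemma card_avoiding_ge:
  assumes Q: "Q \<in> kl_partitions k l" "\<not> inside Q T" and T: "T \<subseteq> {1..k * l}" "card T = t" "t \<ge> 2"
    and kl: "k \<ge> 2" "l \<ge> t + 1" "k * l > 2 * k * k + t"
  defines "M \<equiv> k * 2 ^ k"
  shows "card (canonical_family k l T) \<le> (M + 1) *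
    ((k * l) ^ (2 * M) * card {P \<in> canonical_family k l T. tsets t P \<inter> tsets t Q = {}})"
proof -
  let ?C = "canonical_family k l T"
  have finC: "finite ?C" by (rule finite_canonical_family)
  have finT: "finite T" using T(1) finite_subset by blast
  have CU: "P \<in> kl_partitions k l" "inside P T" if "P \<in> ?C" for P
    using that by (auto simp: canonical_family_def)
  define m where "m P = card (tsets t P \<inter> tsets t Q)" for P
  define N where "N j = {P \<in> ?C. m P \<le> j}" for j
  have finN: "finite (N j)" for j unfolding N_def using finC by simp
  have finQ: "finite (tsets t Q)" using finite_tsets[OF Q(1)] .
  \<comment> \<open>Double counting: \<open>tsets t Q\<close> has at most \<open>l * 2 ^ k\<close>
    members, all different from \<open>T\<close>, and each is inside a proportion of at most
    \<open>k / l\<close> of the family. So the mean of \<open>m\<close> is at most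
    \<open>M\<close>.\<close>
  have "(\<Sum>P\<in>?C. m P) = (\<Sum>P\<in>?C. \<Sum>S\<in>tsets t Q. if inside P S then 1 else 0)"
  proof (rule sum.cong[OF refl])
    fix P assume "P \<in> ?C"
    have "tsets t P \<inter> tsets t Q = {S \<in> tsets t Q. inside P S}" unfolding tsets_def by blast
    then show "m P = (\<Sum>S\<in>tsets t Q. if inside P S then 1 else 0)"
      unfolding m_def using finQ by (simp add: sum.If_cases Int_def)
  qed
  also have "\<dots> = (\<Sum>S\<in>tsets t Q. \<Sum>P\<in>?C. if inside P S then 1 else 0)" by (rule sum.swap)
  also have "\<dots> = (\<Sum>S\<in>tsets t Q. card {P \<in> ?C. inside P S})"
    using finC by (simp add: sum.If_cases Int_def)
  finally have "(\<Sum>P\<in>?C. m P) * l = (\<Sum>S\<in>tsets t Q. card {P \<in> ?C. inside P S} * l)"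
    by (simp add: sum_distrib_right)
  also have "\<dots> \<le> (\<Sum>S\<in>tsets t Q. k * card ?C)"
  proof (rule sum_mono)
    fix S assume S: "S \<in> tsets t Q"
    then have "S \<subseteq> {1..k * l}" "card S = t" "S \<noteq> T" using tsets_subset[OF Q(1)] Q(2) by (auto simp: tsets_def)
    then show "card {P \<in> ?C. inside P S} * l \<le> k * card ?C"
      using T kl finT by (intro card_two_sets_le) (auto intro: finite_subset)
  qed
  also have "\<dots> \<le> l * 2 ^ k * (k * card ?C)"
    using card_inside_le[OF Q(1) subset_refl, of "tsets t Q"] kl_partitionsD(3)[OF Q(1)]
    by (simp add: tsets_def)
  finally have "(\<Sum>P\<in>?C. m P) * l \<le> (M * card ?C) * l" by (simp add: M_def mult_ac)
  then have mean: "(\<Sum>P\<in>?C. m P) \<le> M * card ?C" using kl(2) by simp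
  have "(M + 1) * card (?C - N M) = (\<Sum>P\<in>?C - N M. M + 1)" by simp
  also have "\<dots> \<le> (\<Sum>P\<in>?C - N M. m P)" by (intro sum_mono) (auto simp: N_def)
  also have "\<dots> \<le> (\<Sum>P\<in>?C. m P)" using finC by (intro sum_mono2) auto
  also note mean
  finally have "(M + 1) * card (?C - N M) \<le> M * card ?C" .
  moreover have "N M \<subseteq> ?C" unfolding N_def by blast
  then have "card ?C = card (N M) + card (?C - N M)"
    using finC finN by (metis card_Un_disjoint Diff_disjoint Un_Diff_cancel Un_absorb1 finite_Diff)
  ultimately have half: "card ?C \<le> (M + 1) * card (N M)" by (simp add: algebra_simps)
  have step: "card (N (Suc j)) \<le> (k * l) ^ 2 * card (N j)" for j
  proof -
    let ?R = "{1..k * l} \<times> {1..k * l}"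
    have "N (Suc j) \<subseteq> (\<Union>P\<in>N j. (\<lambda>(y, z). swap_points y z P) ` ?R)"
    proof
      fix P assume P: "P \<in> N (Suc j)"
      then have PC: "P \<in> ?C" and mP: "m P \<le> Suc j" unfolding N_def by auto
      have "\<exists>y\<in>{1..k * l}. \<exists>z\<in>{1..k * l}. swap_points y z P \<in> N j"
      proof (cases "tsets t P \<inter> tsets t Q = {}")
        case True
        then have "P \<in> N j" using PC unfolding N_def m_def by simp
        \<comment> \<open>With nothing left to repair, a point is swapped with itself.\<close>
        moreover have "swap_points 1 1 P = P" unfolding swap_points_def by (simp add: image_ident)
        moreover have "1 \<in> {1..k * l}" using kl(1,2) by simp
        ultimately show ?thesis by metis
      next
        case False
        obtain y z where yz: "y \<in> {1..k * l}" "z \<in> {1..k * l}" "inside (swap_points y z P) T"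
          "m (swap_points y z P) < m P"
          using swap_reduces_intersection[OF CU[OF PC] Q finT T(2,3) False kl(3)] unfolding m_def by blast
        then have "swap_points y z P \<in> N j"
          using swap_points_kl_partitions[OF CU(1)[OF PC] yz(1,2)] mP
          unfolding N_def canonical_family_def by simp
        then show ?thesis using yz by blast
      qed
      then obtain y z where yz: "y \<in> {1..k * l}" "z \<in> {1..k * l}" "swap_points y z P \<in> N j" by blast
      then have "P \<in> (\<lambda>(a, b). swap_points a b (swap_points y z P)) ` ?R"
        using yz by (intro rev_image_eqI[of "(y, z)"]) auto
      then show "P \<in> (\<Union>P\<in>N j. (\<lambda>(y, z). swap_points y z P) ` ?R)"
        by (rule UN_I[OF yz(3)])
    qed
    then have "card (N (Suc j)) \<le> card (\<Union>P\<in>N j. (\<lambda>(y, z). swap_points y z P) ` ?R)"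
      using finN by (intro card_mono) auto
    also have "\<dots> \<le> (\<Sum>P\<in>N j. card ((\<lambda>(y, z). swap_points y z P) ` ?R))" by (rule card_UN_le[OF finN])
    also have "\<dots> \<le> (\<Sum>P\<in>N j. card ?R)" by (intro sum_mono card_image_le) auto
    also have "\<dots> = (k * l) ^ 2 * card (N j)" by (simp add: power2_eq_square card_cartesian_product)
    finally show ?thesis .
  qed
  have "card (N j) \<le> (k * l) ^ (2 * j) * card (N 0)" for j
  proof (induction j)
    case 0 then show ?case by simp
  next
    case (Suc j)
    have "card (N (Suc j)) \<le> (k * l) ^ 2 * card (N j)" by (rule step)
    also have "\<dots> \<le> (k * l) ^ 2 * ((k * l) ^ (2 * j) * card (N 0))" using Suc by (rule mult_le_mono2)
    finally show ?case by (simp add: power_add flip: power2_eq_square mult.assoc)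
  qed
  from mult_le_mono2[OF this[of M], of "M + 1"] half
  have "card ?C \<le> (M + 1) * ((k * l) ^ (2 * M) * card (N 0))" by (rule order_trans[rotated])
  moreover have "N 0 = {P \<in> ?C. tsets t P \<inter> tsets t Q = {}}"
    unfolding N_def m_def using finQ by auto
  ultimately show ?thesis by simp
qed

section \<open>Spread subfamilies\<close>

text \<open>The sets \<open>tsets t P - X\<close> for \<open>P\<close> in \<open>I\<close> form an
  \<open>R\<close>-spread family in the usual sense, and \<open>X\<close> is its core. Sets
  \<open>Z\<close> meeting \<open>X\<close> are exempt because all of \<open>X\<close> lies in every
  \<open>tsets t P\<close>.\<close>

definition spread_at :: "nat \<Rightarrow> real \<Rightarrow> nat set set \<Rightarrow> nat set set set \<Rightarrow> bool" where
  "spread_at t R X I \<longleftrightarrow> I \<noteq> {} \<and> (\<forall>P\<in>I. X \<subseteq> tsets t P) \<and>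
    (\<forall>Z. Z \<noteq> {} \<longrightarrow> Z \<inter> X = {} \<longrightarrow> real (card {P\<in>I. Z \<subseteq> tsets t P}) * R ^ card Z \<le> real (card I))"

text \<open>X is a largest set with card F at most R ^ card X times the number of members of F containing X.\<close>

lemma spread_at_exists:
  assumes F: "F \<subseteq> kl_partitions k l" "F \<noteq> {}" and R: "R \<ge> 1"
  obtains X where "finite X" "spread_at t R X {P\<in>F. X \<subseteq> tsets t P}"
    "real (card F) \<le> R ^ card X * real (card {P\<in>F. X \<subseteq> tsets t P})"
proof -
  define E where "E = {S. S \<subseteq> {1..k * l} \<and> card S = t}"
  have finE: "finite E" unfolding E_def by simp
  have finF: "finite F" using F(1) finite_kl_partitions finite_subset by blast
  define f where "f X = card {P\<in>F. X \<subseteq> tsets t P}" for X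
  define A where "A = {X. X \<subseteq> E \<and> real (card F) \<le> R ^ card X * real (f X)}"
  have "finite A" using finE unfolding A_def by simp
  moreover have "{} \<in> A" unfolding A_def f_def by simp
  ultimately obtain X where X: "X \<in> A" "\<And>Y. Y \<in> A \<Longrightarrow> card Y \<le> card X"
    by (metis (no_types, lifting) empty_iff finite_has_maximal[of "card ` A"] finite_imageI image_iff nat_le_linear)
  have finX: "finite X" using X(1) finE finite_subset unfolding A_def by blast
  have R0: "R > 0" using R by simp
  have F0: "real (card F) > 0" using F(2) finF by (simp add: card_gt_0_iff)
  have "f X \<noteq> 0" using X(1) F0 unfolding A_def by (cases "f X = 0") auto
  then have ne: "{P\<in>F. X \<subseteq> tsets t P} \<noteq> {}" unfolding f_def by (metis card.empty)
  \<comment> \<open>If \<open>Z\<close> violated this, \<open>X \<union> Z\<close> would still be in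
    \<open>A\<close>, against the choice of \<open>X\<close> as largest.\<close>
  have "real (card {P \<in> {P\<in>F. X \<subseteq> tsets t P}. Z \<subseteq> tsets t P}) * R ^ card Z \<le> real (f X)"
    if Z: "Z \<noteq> {}" "Z \<inter> X = {}" for Z
  proof (cases "Z \<subseteq> E")
    case True
    then have finZ: "finite Z" using finE finite_subset by blast
    have eq: "card {P \<in> {P\<in>F. X \<subseteq> tsets t P}. Z \<subseteq> tsets t P} = f (X \<union> Z)"
      unfolding f_def by (rule arg_cong[of _ _ card]) auto
    have c: "card (X \<union> Z) = card X + card Z" using Z finX finZ by (simp add: card_Un_disjoint Int_commute)
    have "card Z \<noteq> 0" using Z finZ by simp
    then have "X \<union> Z \<notin> A" using X(2)[of "X \<union> Z"] c by linarith
    then have "R ^ (card X + card Z) * real (f (X \<union> Z)) \<le> real (card F)"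
      using True X(1) c unfolding A_def by auto
    also have "\<dots> \<le> R ^ card X * real (f X)" using X(1) unfolding A_def by blast
    finally have "R ^ card X * (R ^ card Z * real (f (X \<union> Z))) \<le> R ^ card X * real (f X)"
      by (simp add: power_add mult.assoc)
    then have "R ^ card Z * real (f (X \<union> Z)) \<le> real (f X)"
      using R0 by (subst (asm) mult_le_cancel_left_pos) simp_all
    then show ?thesis unfolding eq by (simp add: mult.commute)
  next
    case False
    have "\<not> Z \<subseteq> tsets t P" if "P \<in> F" for P
      using False tsets_subset[of P k l t] F(1) that unfolding E_def by blast
    then have "{P \<in> {P\<in>F. X \<subseteq> tsets t P}. Z \<subseteq> tsets t P} = {}" by blast
    then show ?thesis by (simp only:) simp
  qed
  then have "spread_at t R X {P\<in>F. X \<subseteq> tsets t P}"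
    using ne unfolding spread_at_def f_def by blast
  moreover have "real (card F) \<le> R ^ card X * real (card {P\<in>F. X \<subseteq> tsets t P})"
    using X(1) unfolding A_def f_def by blast
  ultimately show ?thesis using that finX by blast
qed

text \<open>Union bound: by spreadness each \<open>S\<close> in \<open>Y\<close> occurs in at most
  \<open>card I / R\<close> members, so at most half of \<open>I\<close> is discarded. This halving
  is the source of the factor 2 in the spread condition.\<close>

lemma spread_at_restrict:
  assumes I: "I \<subseteq> kl_partitions k l" "spread_at t R X I" and Y: "finite Y" "2 * real (card Y) \<le> R" "X \<inter> Y = {}"
    and R: "R > 0"
  defines "I' \<equiv> {P\<in>I. tsets t P \<inter> Y = {}}"
  shows "I' \<noteq> {}"
    and "\<And>Z. Z \<noteq> {} \<Longrightarrow> real (card {P\<in>I'. Z \<subseteq> tsets t P - X}) * R ^ card Z \<le> 2 * real (card I')"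
proof -
  have finI: "finite I" using I(1) finite_kl_partitions finite_subset by blast
  have sp: "real (card {P\<in>I. Z \<subseteq> tsets t P}) * R ^ card Z \<le> real (card I)" if "Z \<noteq> {}" "Z \<inter> X = {}" for Z
    using I(2) that unfolding spread_at_def by blast
  have I0: "card I > 0" using I(2) finI unfolding spread_at_def by (simp add: card_gt_0_iff)
  have "I - I' \<subseteq> (\<Union>S\<in>Y. {P\<in>I. {S} \<subseteq> tsets t P})" unfolding I'_def by blast
  then have "card (I - I') \<le> card (\<Union>S\<in>Y. {P\<in>I. {S} \<subseteq> tsets t P})"
    using finI Y(1) by (intro card_mono) auto
  also have "\<dots> \<le> (\<Sum>S\<in>Y. card {P\<in>I. {S} \<subseteq> tsets t P})" by (rule card_UN_le[OF Y(1)])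
  finally have "real (card (I - I')) \<le> real (\<Sum>S\<in>Y. card {P\<in>I. {S} \<subseteq> tsets t P})"
    by (rule of_nat_mono)
  then have "real (card (I - I')) * R \<le> real (\<Sum>S\<in>Y. card {P\<in>I. {S} \<subseteq> tsets t P}) * R"
    using R by (intro mult_right_mono) auto
  also have "\<dots> = (\<Sum>S\<in>Y. real (card {P\<in>I. {S} \<subseteq> tsets t P}) * R ^ card {S})"
    by (simp only: of_nat_sum sum_distrib_right) simp
  also have "\<dots> \<le> (\<Sum>S\<in>Y. real (card I))" using Y(3) by (intro sum_mono sp) auto
  finally have "2 * (real (card (I - I')) * R) \<le> (2 * real (card Y)) * real (card I)" by simp
  also have "\<dots> \<le> R * real (card I)" using Y(2) by (intro mult_right_mono) auto
  finally have "R * (2 * real (card (I - I'))) \<le> R * real (card I)" by (simp add: mult_ac)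
  then have "2 * real (card (I - I')) \<le> real (card I)" using R by (subst (asm) mult_le_cancel_left_pos) simp_all
  moreover have "I' \<subseteq> I" unfolding I'_def by blast
  then have "card (I - I') = card I - card I'" "card I' \<le> card I"
    using finI by (auto simp: card_Diff_subset finite_subset card_mono)
  ultimately have half: "real (card I) \<le> 2 * real (card I')" by (simp add: of_nat_diff)
  then show "I' \<noteq> {}" using I0 by auto
  show "real (card {P\<in>I'. Z \<subseteq> tsets t P - X}) * R ^ card Z \<le> 2 * real (card I')" if Z: "Z \<noteq> {}" for Z
  proof (cases "Z \<inter> X = {}")
    case True
    have "card {P\<in>I'. Z \<subseteq> tsets t P - X} \<le> card {P\<in>I. Z \<subseteq> tsets t P}"
      using finI unfolding I'_def by (intro card_mono) auto
    then have "real (card {P\<in>I'. Z \<subseteq> tsets t P - X}) * R ^ card Z \<le> real (card {P\<in>I. Z \<subseteq> tsets t P}) * R ^ card Z"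
      using R by (intro mult_right_mono) auto
    also have "\<dots> \<le> real (card I)" by (rule sp[OF Z True])
    also note half
    finally show ?thesis .
  next
    case False
    then have "{P\<in>I'. Z \<subseteq> tsets t P - X} = {}" by blast
    then show ?thesis by (simp only:) simp
  qed
qed

text \<open>Once the members of \<open>I\<close> touching \<open>Y\<close> and those of
  \<open>J\<close> touching \<open>X\<close> are discarded, a common \<open>t\<close>-set can lie in
  neither core. So it suffices that \<open>tsets t P - X\<close> and \<open>tsets t Q - Y\<close> be
  disjoint, which \<open>cross_spread\<close> provides.\<close>

lemma spread_at_disjoint_members:
  assumes I: "I \<subseteq> kl_partitions k l" "spread_at t R X I" and J: "J \<subseteq> kl_partitions k l" "spread_at t R Y J"
    and XY: "finite X" "finite Y" "2 * real (card X) \<le> R" "2 * real (card Y) \<le> R" "X \<inter> Y = {}"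
    and s: "(k * l) choose t < 2 ^ s" "s \<ge> 1" "R > 64 * real s ^ 3"
  shows "\<exists>P\<in>I. \<exists>Q\<in>J. tsets t P \<inter> tsets t Q = {}"
proof -
  have "64 * real s ^ 3 \<ge> 0" by simp
  then have R0: "R > 0" using s(3) by linarith
  define E where "E = {S. S \<subseteq> {1..k * l} \<and> card S = t}"
  have E: "finite E" "card E < 2 ^ s" using s(1) unfolding E_def by (simp_all add: n_subsets)
  define I' where "I' = {P\<in>I. tsets t P \<inter> Y = {}}"
  define J' where "J' = {P\<in>J. tsets t P \<inter> X = {}}"
  note rI = spread_at_restrict[OF I XY(2,4,5) R0, folded I'_def]
  note rJ = spread_at_restrict[OF J XY(1,3) _ R0, unfolded Int_commute[of Y X], OF XY(5), folded J'_def]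
  have "\<exists>P\<in>I'. \<exists>Q\<in>J'. (tsets t P - X) \<inter> (tsets t Q - Y) = {}"
  proof (rule cross_spread[OF E s(2,3)])
    show "finite I'" "finite J'" unfolding I'_def J'_def
      using I(1) J(1) by (auto intro: finite_subset[OF _ finite_kl_partitions])
    show "tsets t P - X \<subseteq> E" if "P \<in> I'" for P using that tsets_subset[of P k l t] I(1) unfolding I'_def E_def by blast
    show "tsets t P - Y \<subseteq> E" if "P \<in> J'" for P using that tsets_subset[of P k l t] J(1) unfolding J'_def E_def by blast
  qed (fact rI(1) rJ(1) rI(2) rJ(2))+
  then obtain P Q where PQ: "P \<in> I'" "Q \<in> J'" "(tsets t P - X) \<inter> (tsets t Q - Y) = {}" by blast
  then have "tsets t P \<inter> tsets t Q = {}" unfolding I'_def J'_def by blast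
  then show ?thesis using PQ unfolding I'_def J'_def by blast
qed

text \<open>The core \<open>X\<close> of a spread subfamily is large by \<open>nospread\<close>, so
  at most \<open>(2 / l) ^ b\<close> of all partitions contain it, with
  \<open>b \<ge> 2 * N\<close>. Passing from \<open>F\<close> to its members containing
  \<open>X\<close> loses a factor of at most \<open>R ^ card X\<close>, and the choice of
  \<open>R\<close> limits this to \<open>(l / 2) ^ (b / 2)\<close>: half of the exponent
  survives.\<close>

lemma card_uncovered_le:
  fixes R :: real
  assumes F: "F \<subseteq> kl_partitions k l" and tk: "t \<ge> 2" "k \<ge> 2"
    and R: "R \<ge> 1" "R ^ (2 * 2 ^ (k + 1)) = real l / 2"
    and nospread: "\<And>X I. finite X \<Longrightarrow> card X \<le> 2 * 2 ^ (k + 1) * N \<Longrightarrow> I \<subseteq> F \<Longrightarrow> \<not> spread_at t R X I"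
  shows "real (card F) * (real l / 2) ^ N \<le> real (card (kl_partitions k l))"
proof (cases "F = {}")
  case False
  define h :: nat where "h = 2 ^ (k + 1)"
  let ?U = "kl_partitions k l"
  have R0: "R > 0" using R by simp
  have u: "real l / 2 = R ^ (2 * h)" using R(2) unfolding h_def by simp
  have l0: "real l > 0" using u R0 by (metis half_gt_zero_iff zero_less_power)
  obtain X where X: "finite X" "spread_at t R X {P\<in>F. X \<subseteq> tsets t P}"
    "real (card F) \<le> R ^ card X * real (card {P\<in>F. X \<subseteq> tsets t P})"
    using spread_at_exists[OF F False R(1)] .
  have Xq: "card X > 2 * h * N" using nospread[OF X(1), of "{P\<in>F. X \<subseteq> tsets t P}"] X(2) unfolding h_def by fastforce
  obtain b where b: "card X \<le> h * b" "card {P \<in> ?U. X \<subseteq> tsets t P} * l ^ b \<le> 2 ^ b * card ?U"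
    using card_superfamily_le[OF tk] unfolding h_def by blast
  have "2 * h * N < h * b" using Xq b(1) by (rule less_le_trans)
  then have "h * (2 * N) < h * b" by (simp only: mult_ac)
  then have bN: "2 * N \<le> b" by simp
  have "real (card {P \<in> ?U. X \<subseteq> tsets t P}) * real l ^ b \<le> 2 ^ b * real (card ?U)"
    using of_nat_mono[OF b(2), where ?'a = real] by simp
  then have UX: "real (card {P \<in> ?U. X \<subseteq> tsets t P}) * (real l / 2) ^ b \<le> real (card ?U)"
    by (simp add: power_divide field_simps)
  have "real (card F) \<le> R ^ (h * b) * real (card {P \<in> ?U. X \<subseteq> tsets t P})"
  proof -
    have "card {P\<in>F. X \<subseteq> tsets t P} \<le> card {P \<in> ?U. X \<subseteq> tsets t P}"
      using F finite_kl_partitions by (intro card_mono) auto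
    then have "R ^ card X * real (card {P\<in>F. X \<subseteq> tsets t P}) \<le> R ^ (h * b) * real (card {P \<in> ?U. X \<subseteq> tsets t P})"
      using R(1) b(1) by (intro mult_mono power_increasing) auto
    with X(3) show ?thesis by linarith
  qed
  then have "real (card F) * (real l / 2) ^ b \<le> R ^ (h * b) * real (card {P \<in> ?U. X \<subseteq> tsets t P}) * (real l / 2) ^ b"
    using l0 by (intro mult_right_mono) auto
  also have "\<dots> \<le> R ^ (h * b) * real (card ?U)"
    using UX R0 by (simp only: mult.assoc) (intro mult_left_mono, auto)
  also have "(real l / 2) ^ b = R ^ (h * b) * R ^ (h * b)"
  proof -
    have "2 * h * b = h * b + h * b" by simp
    then show ?thesis unfolding u power_mult[symmetric] power_add[symmetric] by (rule arg_cong)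
  qed
  finally have "R ^ (h * b) * (real (card F) * R ^ (h * b)) \<le> R ^ (h * b) * real (card ?U)"
    by (simp only: mult_ac)
  then have "real (card F) * R ^ (h * b) \<le> real (card ?U)"
    using R0 by (subst (asm) mult_le_cancel_left_pos) simp_all
  moreover have "(real l / 2) ^ N \<le> R ^ (h * b)"
  proof -
    have "(real l / 2) ^ N = R ^ (h * (2 * N))" unfolding u by (simp add: mult_ac flip: power_mult)
    also have "\<dots> \<le> R ^ (h * b)" using R(1) bN by (intro power_increasing) auto
    finally show ?thesis .
  qed
  then have "real (card F) * (real l / 2) ^ N \<le> real (card F) * R ^ (h * b)" by (intro mult_left_mono) auto
  ultimately show ?thesis by linarith
qed simp

section \<open>The bound for fixed parameters\<close>

lemma partially_t_intersecting_bound: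
  fixes R :: real
  assumes F: "F \<subseteq> kl_partitions k l" "partially_t_intersecting t F" and T: "T \<subseteq> {1..k * l}" "card T = t"
    and tk: "t \<ge> 2" "t \<le> k" and l: "l \<ge> t + 1" "k * l > 2 * k * k + t"
    and R: "R ^ (2 * 2 ^ (k + 1)) = real l / 2" "2 * real q \<le> R"
    and s: "(k * l) choose t < 2 ^ s" "s \<ge> 1" "R > 64 * real s ^ 3"
    and MN: "M = k * 2 ^ k" "q = 2 * 2 ^ (k + 1) * N"
    and small: "real (M + 1) * real (k * l) ^ (t + 2 * M) < (real l / 2) ^ N" "2 * q * q * k \<le> l"
  shows "card F \<le> card (canonical_family k l T) \<and>
       (card F = card (canonical_family k l T) \<longrightarrow>
          (\<exists>S. S \<subseteq> {1..k * l} \<and> card S = t \<and> F = canonical_family k l S))"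
proof (cases "F = {}")
  case True
  then show ?thesis using T finite_canonical_family[of k l T] by auto
next
  case F0: False
  let ?U = "kl_partitions k l" and ?C = "canonical_family k l T"
  have k2: "k \<ge> 2" using tk by simp
  have finF: "finite F" using F(1) finite_kl_partitions finite_subset by blast
  have "real s ^ 3 \<ge> 1" using s(2) by simp
  then have R1: "R \<ge> 1" using s(3) by linarith
  have UC: "card ?U \<le> (k * l) ^ t * card ?C" using card_kl_partitions_le[OF T tk(2)] l by simp
  have "card ?U > 0" using F0 F(1) finite_kl_partitions by (auto simp: card_gt_0_iff)
  with UC have "0 < (k * l) ^ t * card ?C" by (rule less_le_trans[rotated])
  then have C0: "card ?C > 0" unfolding nat_0_less_mult_iff by (rule conjunct2)
  have CS: "card (canonical_family k l S) = card ?C" if "S \<subseteq> {1..k * l}" "card S = t" for S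
    using card_canonical_family_eq[OF that(1) T(1)] that(2) T(2) by simp
  \<comment> \<open>The small cores. Their size limit \<open>q\<close> is the threshold of
    \<open>card_uncovered_le\<close>, which therefore applies to the uncovered remainder
    \<open>F'\<close>.\<close>
  define \<X> where "\<X> = {X. finite X \<and> card X \<le> q \<and> (\<exists>I\<subseteq>F. spread_at t R X I)}"
  define F' where "F' = {P\<in>F. \<forall>X\<in>\<X>. \<not> X \<subseteq> tsets t P}"
  have F'F: "F' \<subseteq> F" unfolding F'_def by blast
  have finF': "finite F'" using F'F finF finite_subset by blast
  have "real (card F') * (real l / 2) ^ N \<le> real (card ?U)"
  proof (rule card_uncovered_le[OF _ tk(1) k2 R1 R(1)])
    show "F' \<subseteq> ?U" using F'F F(1) by blast
    fix X :: "nat set set" and I assume X: "finite X" "card X \<le> 2 * 2 ^ (k + 1) * N" and I: "I \<subseteq> F'"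
    show "\<not> spread_at t R X I"
    proof
      assume sp: "spread_at t R X I"
      then have "X \<in> \<X>" using X I F'F MN(2) unfolding \<X>_def by blast
      moreover obtain P where "P \<in> I" "X \<subseteq> tsets t P" using sp unfolding spread_at_def by blast
      ultimately show False using I unfolding F'_def by blast
    qed
  qed
  also have "real (card ?U) \<le> real (k * l) ^ t * real (card ?C)"
    using of_nat_mono[OF UC, where ?'a = real] by simp
  finally have F'1: "real (card F') * (real l / 2) ^ N \<le> real (k * l) ^ t * real (card ?C)" .
  \<comment> \<open>The weight \<open>(M + 1) * (k * l) ^ (2 * M)\<close> is the loss in
    \<open>card_avoiding_ge\<close>; even with this weight the remainder stays below the size of a
    canonical family.\<close>
  have "real (card F' * ((M + 1) * (k * l) ^ (2 * M))) * (real l / 2) ^ N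
      = real ((M + 1) * (k * l) ^ (2 * M)) * (real (card F') * (real l / 2) ^ N)"
    by (simp only: of_nat_mult mult_ac)
  also have "\<dots> \<le> real ((M + 1) * (k * l) ^ (2 * M)) * (real (k * l) ^ t * real (card ?C))"
    using F'1 by (rule mult_left_mono) simp
  also have "\<dots> = (real (M + 1) * real (k * l) ^ (t + 2 * M)) * real (card ?C)"
    by (simp only: power_add of_nat_mult of_nat_power mult_ac)
  also have "\<dots> < (real l / 2) ^ N * real (card ?C)"
    using small(1) C0 by (intro mult_strict_right_mono) simp_all
  finally have "real (card F' * ((M + 1) * (k * l) ^ (2 * M))) * (real l / 2) ^ N
    < real (card ?C) * (real l / 2) ^ N" by (simp add: mult.commute)
  then have F'small: "card F' * ((M + 1) * (k * l) ^ (2 * M)) < card ?C"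
    using l(1) by (subst (asm) mult_less_cancel_right_pos) (simp_all only: of_nat_less_iff, simp)
  have "2 * 1 \<le> (M + 1) * (k * l) ^ (2 * M)"
    using k2 l(1) unfolding MN(1) by (intro mult_le_mono) auto
  then have "card F' * 2 \<le> card F' * ((M + 1) * (k * l) ^ (2 * M))" by (intro mult_le_mono) simp_all
  with F'small have F'half: "2 * card F' < card ?C" by linarith
  have meet: "X \<inter> Y \<noteq> {}" if XY: "X \<in> \<X>" "Y \<in> \<X>" for X Y
  proof
    assume dis: "X \<inter> Y = {}"
    obtain I J where IJ: "I \<subseteq> F" "spread_at t R X I" "J \<subseteq> F" "spread_at t R Y J"
      using XY unfolding \<X>_def by blast
    have q: "finite X" "finite Y" "2 * real (card X) \<le> R" "2 * real (card Y) \<le> R"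
      using XY R(2) unfolding \<X>_def by auto
    obtain P Q where "P \<in> I" "Q \<in> J" "tsets t P \<inter> tsets t Q = {}"
      using spread_at_disjoint_members[OF _ IJ(2) _ IJ(4) q dis s] IJ(1,3) F(1) by blast
    then show False using F IJ(1,3) partially_t_intersect_iff unfolding partially_t_intersecting_def by blast
  qed
  have tset: "S \<subseteq> {1..k * l} \<and> card S = t" if "X \<in> \<X>" "S \<in> X" for X S
  proof -
    obtain I where I: "I \<subseteq> F" "spread_at t R X I" using \<open>X \<in> \<X>\<close> unfolding \<X>_def by blast
    then obtain P where "P \<in> I" "X \<subseteq> tsets t P" unfolding spread_at_def by blast
    then show ?thesis using tsets_subset[of P k l t] I(1) F(1) that(2) by blast
  qed
  have strict: ?thesis if "card F < card ?C" using that by simp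
  show ?thesis
  proof (cases "\<X> = {}")
    case True
    then have "F' = F" unfolding F'_def by blast
    then show ?thesis using F'half strict by simp
  next
    case False
    then obtain X1 where X1: "X1 \<in> \<X>" by blast
    show ?thesis
    proof (cases "\<exists>S. \<forall>X\<in>\<X>. S \<in> X")
      case True
      then obtain S where S: "\<And>X. X \<in> \<X> \<Longrightarrow> S \<in> X" by blast
      have St: "S \<subseteq> {1..k * l}" "card S = t" using tset[OF X1 S[OF X1]] by auto
      let ?D = "canonical_family k l S"
      have cover: "P \<in> F'" if P: "P \<in> F" "\<not> inside P S" for P
      proof -
        have "S \<notin> tsets t P" using P unfolding tsets_def by blast
        then show ?thesis using S P(1) unfolding F'_def by blast
      qed
      show ?thesis
      proof (cases "\<forall>Q\<in>F. inside Q S")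
        case True
        then have FD: "F \<subseteq> ?D" using F(1) unfolding canonical_family_def by blast
        then have "card F \<le> card ?C" using CS[OF St] card_mono[OF finite_canonical_family] by metis
        moreover have "F = ?D" if "card F = card ?C"
          using card_subset_eq[OF finite_canonical_family FD] that CS[OF St] by simp
        ultimately show ?thesis using St by blast
      next
        case False
        then obtain Q where Q: "Q \<in> F" "\<not> inside Q S" by blast
        define G where "G = {P \<in> ?D. tsets t P \<inter> tsets t Q = {}}"
        have finG: "finite G" unfolding G_def using finite_canonical_family by simp
        have "Q \<in> ?U" using Q F(1) by blast
        from card_avoiding_ge[OF this Q(2) St tk(1) k2 l]
        have G: "card ?C \<le> (M + 1) * (k * l) ^ (2 * M) * card G"
          unfolding G_def CS[OF St] MN(1) by (simp only: mult.assoc)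
        \<comment> \<open>\<open>F\<close> and \<open>G\<close> are disjoint and both lie in
          \<open>?D \<union> F'\<close>. Hence \<open>card F \<ge> card ?C\<close> would give
          \<open>card G \<le> card F'\<close>, against the weighted bound on
          \<open>F'\<close>.\<close>
        have "P \<notin> G" if "P \<in> F" for P
        proof -
          have "partially_t_intersect t P Q" using F(2) that Q(1) unfolding partially_t_intersecting_def by blast
          then show ?thesis using partially_t_intersect_iff[of P k l t Q] F(1) that unfolding G_def by blast
        qed
        then have "card F + card G = card (F \<union> G)" using finF finG by (subst card_Un_disjoint) auto
        also have "\<dots> \<le> card (?D \<union> F')"
        proof (rule card_mono)
          have "F \<subseteq> ?D \<union> F'" using cover F(1) unfolding canonical_family_def by blast
          then show "F \<union> G \<subseteq> ?D \<union> F'" unfolding G_def by blast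
        qed (simp add: finF' finite_canonical_family)
        also have "\<dots> \<le> card ?D + card F'" by (rule card_Un_le)
        finally have sum: "card F + card G \<le> card ?C + card F'" unfolding CS[OF St] .
        have "card F < card ?C"
        proof (rule ccontr)
          assume "\<not> card F < card ?C"
          then have "card G \<le> card F'" using sum by linarith
          then have "(M + 1) * (k * l) ^ (2 * M) * card G \<le> (M + 1) * (k * l) ^ (2 * M) * card F'" by (rule mult_le_mono2)
          then show False using G F'small by (simp only: mult.commute[of "card F'"])
        qed
        then show ?thesis by (rule strict)
      qed
    next
      case False
      \<comment> \<open>\<open>g S\<close> is a core missing \<open>S\<close>. A covered
        \<open>P\<close> contains a core that meets \<open>X1\<close> in some \<open>S1\<close> and
        \<open>g S1\<close> in some \<open>S2\<close>, and \<open>S2\<close> differs from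
        \<open>S1\<close>; there are at most \<open>q * q\<close> such pairs.\<close>
      then obtain g where g: "\<And>S. g S \<in> \<X> \<and> S \<notin> g S" by metis
      define B where "B = (\<lambda>(S1, S2). {P \<in> canonical_family k l S1. inside P S2})"
      let ?W = "SIGMA S1 : X1. g S1"
      have fing: "finite (g S)" "card (g S) \<le> q" for S using g[of S] unfolding \<X>_def by auto
      have fin1: "finite X1" "card X1 \<le> q" using X1 unfolding \<X>_def by auto
      have finW: "finite ?W" using fin1 fing by blast
      have "card ?W = (\<Sum>S\<in>X1. card (g S))" using fin1 fing by (intro card_SigmaI) auto
      also have "\<dots> \<le> (\<Sum>S\<in>X1. q)" using fing by (intro sum_mono) auto
      also have "\<dots> \<le> q * q" using fin1 by simp
      finally have cardW: "card ?W \<le> q * q" .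
      have "F \<subseteq> F' \<union> (\<Union>w\<in>?W. B w)"
      proof
        fix P assume P: "P \<in> F"
        show "P \<in> F' \<union> (\<Union>w\<in>?W. B w)"
        proof (cases "P \<in> F'")
          case False
          then obtain X where X: "X \<in> \<X>" "X \<subseteq> tsets t P" using P unfolding F'_def by blast
          obtain S1 where S1: "S1 \<in> X" "S1 \<in> X1" using meet[OF X(1) X1] by blast
          obtain S2 where S2: "S2 \<in> X" "S2 \<in> g S1" using meet[OF X(1), of "g S1"] g by blast
          have "inside P S1" "inside P S2" using X(2) S1(1) S2(1) unfolding tsets_def by blast+
          then have "P \<in> B (S1, S2)" using P F(1) unfolding B_def canonical_family_def by auto
          then show ?thesis using S1 S2 by blast
        qed simp
      qed
      then have "card F \<le> card (F' \<union> (\<Union>w\<in>?W. B w))"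
        using finF' finW finite_canonical_family by (intro card_mono) (auto simp: B_def)
      also have "\<dots> \<le> card F' + card (\<Union>w\<in>?W. B w)" by (rule card_Un_le)
      also have "card (\<Union>w\<in>?W. B w) \<le> (\<Sum>w\<in>?W. card (B w))" by (rule card_UN_le[OF finW])
      finally have "card F * l \<le> (card F' + (\<Sum>w\<in>?W. card (B w))) * l" by (meson add_left_mono mult_le_mono1)
      also have "\<dots> = card F' * l + (\<Sum>w\<in>?W. card (B w) * l)"
        by (simp add: distrib_right sum_distrib_right)
      also have "(\<Sum>w\<in>?W. card (B w) * l) \<le> (\<Sum>w\<in>?W. k * card ?C)"
      proof (rule sum_mono)
        fix w assume "w \<in> ?W"
        then obtain S1 S2 where w: "w = (S1, S2)" "S1 \<in> X1" "S2 \<in> g S1" by blast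
        have 1: "S1 \<subseteq> {1..k * l}" "card S1 = t" using tset[OF X1 w(2)] by auto
        have 2: "S2 \<subseteq> {1..k * l}" "card S2 = t" using tset[of "g S1" S2] g w(3) by auto
        have "card (B w) * l \<le> k * card (canonical_family k l S1)"
          unfolding w(1) B_def prod.case using w(3) g[of S1] 1 2 tk l k2
          by (intro card_two_sets_le) (auto intro: finite_subset)
        then show "card (B w) * l \<le> k * card ?C" unfolding CS[OF 1] .
      qed
      also have "\<dots> = card ?W * (k * card ?C)" by simp
      also have "\<dots> \<le> q * q * (k * card ?C)" using cardW by (rule mult_le_mono1)
      finally have 1: "card F * l \<le> card F' * l + q * q * (k * card ?C)" by simp
      \<comment> \<open>The remainder accounts for strictly less than half of \<open>card ?C\<close>
        and the pairs for at most half, so equality is excluded as well.\<close>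
      have 2: "(2 * q * q * k) * card ?C \<le> l * card ?C" using small(2) by (rule mult_le_mono1)
      have "l * (2 * card F') < l * card ?C" using F'half l by simp
      moreover have "2 * (card F * l) \<le> l * (2 * card F') + (2 * q * q * k) * card ?C"
        using mult_le_mono2[OF 1, of 2] by (simp only: distrib_left mult_ac)
      ultimately have "2 * (card F * l) < 2 * (l * card ?C)" using 2 by linarith
      then show ?thesis using strict by simp
    qed
  qed
qed

section \<open>Choice of the parameters for large \<open>l\<close>\<close>

text \<open>A fixed positive power of \<open>l\<close> outgrows every power of its logarithm, and
  \<open>N > t + 2 * M\<close> leaves a spare factor \<open>l\<close> to beat the constants. The
  logarithmic expression is a real upper bound for the integer \<open>s\<close> chosen
  later.\<close>

lemma eventually_spread_parameters:
  fixes k t M q N :: nat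
  assumes "k \<ge> 2" "t \<ge> 2" "N > t + 2 * M"
  defines "h \<equiv> real (2 * 2 ^ (k + 1))"
  shows "\<forall>\<^sub>F l in sequentially. l \<ge> t + 1 \<and> k * l > 2 * k * k + t \<and> 2 * real q \<le> (real l / 2) powr (1 / h) \<and>
    (real l / 2) powr (1 / h) > 64 * (real t * (log 2 (real k * real l) + 1)) ^ 3 \<and>
    real (M + 1) * real (k * l) ^ (t + 2 * M) < (real l / 2) ^ N \<and> 2 * q * q * k \<le> l"
proof -
  have h: "h > 0" unfolding h_def by simp
  have kt: "real k > 0" "real t > 0" using assms by auto
  have 1: "\<forall>\<^sub>F l in sequentially. l \<ge> t + 1" "\<forall>\<^sub>F l in sequentially. l \<ge> 2 * q * q * k" "\<forall>\<^sub>F l in sequentially. l \<ge> 2 * k * k + t + 1"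
    by (rule eventually_ge_at_top)+
  have 2: "\<forall>\<^sub>F l in sequentially. 2 * real q \<le> (real l / 2) powr (1 / h)" using h by real_asymp
  have 3: "\<forall>\<^sub>F l in sequentially. (real l / 2) powr (1 / h) > 64 * (real t * (log 2 (real k * real l) + 1)) ^ 3"
    using h kt unfolding log_def by real_asymp
  define c where "c = real (M + 1) * real k ^ (t + 2 * M) * 2 ^ N"
  have 4: "\<forall>\<^sub>F l in sequentially. real (M + 1) * real (k * l) ^ (t + 2 * M) < (real l / 2) ^ N"
  proof -
    have "\<forall>\<^sub>F l in sequentially. c < real l" by real_asymp
    then have "\<forall>\<^sub>F l in sequentially. c < real l \<and> l \<ge> 1" using eventually_ge_at_top[of 1] by eventually_elim simp
    then show ?thesis
    proof eventually_elim
      case (elim l)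
      have "c * real l ^ (t + 2 * M) < real l * real l ^ (t + 2 * M)"
        using elim by (intro mult_strict_right_mono) auto
      also have "\<dots> = real l ^ (t + 2 * M + 1)" by simp
      also have "\<dots> \<le> real l ^ N" using assms(3) elim by (intro power_increasing) auto
      finally show ?case unfolding c_def by (simp add: power_divide field_simps power_mult_distrib)
    qed
  qed
  from 1 2 3 4 show ?thesis
  proof eventually_elim
    case (elim l)
    have "l \<le> k * l" using assms(1) by simp
    then show ?case using elim by linarith
  qed
qed

theorem theorem8:
  fixes k t :: nat
  assumes "k \<ge> 1" and "t \<ge> 1"
  shows "\<exists>l0::nat. \<forall>l\<ge>l0. \<forall>F.
    F \<subseteq> kl_partitions k l \<and> partially_t_intersecting t F \<longrightarrow>
    (\<forall>T. T \<subseteq> {1..k * l} \<and> card T = t \<longrightarrow>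
       card F \<le> card (canonical_family k l T) \<and>
       (card F = card (canonical_family k l T) \<longrightarrow>
          (\<exists>S. S \<subseteq> {1..k * l} \<and> card S = t \<and> F = canonical_family k l S)))"
proof -
  consider "t > k" | "t = 1" | "2 \<le> t" "t \<le> k" using assms by linarith
  then show ?thesis
  proof cases
    case 1
    \<comment> \<open>Each member would have to partially \<open>t\<close>-intersect itself, but its
      parts have fewer than \<open>t\<close> points. With \<open>F\<close> empty, equality means
      that the canonical family is empty too.\<close>
    have "F = {}" if F: "F \<subseteq> kl_partitions k l" "partially_t_intersecting t F" for l F
    proof (rule ccontr)
      assume "F \<noteq> {}"
      then obtain P where P: "P \<in> F" by blast
      obtain p q where pq: "p \<in> P" "q \<in> P" "t \<le> card (p \<inter> q)"
        using F(2) P unfolding partially_t_intersecting_def partially_t_intersect_def by blast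
      have "P \<in> kl_partitions k l" using P F(1) by blast
      note D = kl_partitionsD[OF this]
      have "card (p \<inter> q) \<le> k" using D(4,5)[OF pq(1)] by (metis card_mono inf_le1)
      then show False using pq 1 by simp
    qed
    moreover have "canonical_family k l T = {}" if "card (canonical_family k l T) = 0" for l T
      using that finite_canonical_family by simp
    ultimately have "card F \<le> card (canonical_family k l T) \<and> (card F = card (canonical_family k l T) \<longrightarrow>
        F = canonical_family k l T)" if "F \<subseteq> kl_partitions k l" "partially_t_intersecting t F" for l F T
      using that by (metis card.empty le0)
    then show ?thesis by blast
  next
    case 2
    \<comment> \<open>Every point lies in some part, so a singleton \<open>T\<close> imposes no
      condition.\<close>
    have "canonical_family k l T = kl_partitions k l" if T: "T \<subseteq> {1..k * l}" "card T = t" for l T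
    proof -
      obtain x where x: "T = {x}" using T(2) 2 by (metis card_1_singletonE)
      have "inside P T" if "P \<in> kl_partitions k l" for P
        using kl_partitionsD(1)[OF that] T(1) unfolding x by blast
      then show ?thesis unfolding canonical_family_def by blast
    qed
    then show ?thesis by (metis card_mono card_subset_eq finite_kl_partitions)
  next
    case 3
    define M where "M = k * 2 ^ k"
    define N where "N = t + 2 * M + 1"
    define q where "q = 2 * 2 ^ (k + 1) * N"
    have k2: "k \<ge> 2" using 3 by simp
    obtain l0 where l0: "\<And>l. l \<ge> l0 \<Longrightarrow> l \<ge> t + 1 \<and> k * l > 2 * k * k + t \<and>
      2 * real q \<le> (real l / 2) powr (1 / real (2 * 2 ^ (k + 1))) \<and>
      (real l / 2) powr (1 / real (2 * 2 ^ (k + 1))) > 64 * (real t * (log 2 (real k * real l) + 1)) ^ 3 \<and>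
      real (M + 1) * real (k * l) ^ (t + 2 * M) < (real l / 2) ^ N \<and> 2 * q * q * k \<le> l"
      using eventually_spread_parameters[OF k2 3(1), of M N q] unfolding N_def eventually_sequentially by auto
    show ?thesis
    proof (intro exI[of _ l0] allI impI, elim conjE)
      fix l F T
      assume l: "l0 \<le> l" and F: "F \<subseteq> kl_partitions k l" "partially_t_intersecting t F"
        and T: "T \<subseteq> {1..k * l}" "card T = t"
      define R where "R = (real l / 2) powr (1 / real (2 * 2 ^ (k + 1)))"
      note L = l0[OF l, folded R_def]
      have l_pos: "l \<ge> 1" using L by linarith
      have R: "R ^ (2 * 2 ^ (k + 1)) = real l / 2"
        using l_pos unfolding R_def by (subst powr_realpow[symmetric]) (simp_all add: powr_powr)
      \<comment> \<open>The binary length of \<open>k * l\<close>, so that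
        \<open>(k * l) ^ t < 2 ^ s\<close>; the bound \<open>log 2 (k * l) + 1\<close> on it keeps
        \<open>s\<close> small enough for \<open>R\<close>.\<close>
      define L2 where "L2 = nat \<lfloor>log 2 (real (k * l))\<rfloor> + 1"
      define s where "s = t * L2"
      have kl1: "k * l \<ge> 1" using l_pos k2 by simp
      have log0: "log 2 (real (k * l)) \<ge> 0" using kl1 by (simp add: zero_le_log_cancel_iff del: of_nat_mult)
      have L2: "log 2 (real (k * l)) < real L2" "real L2 \<le> log 2 (real (k * l)) + 1"
        using log0 unfolding L2_def by linarith+
      have "real (k * l) < 2 powr real L2" using L2(1) kl1 by (subst (asm) log_less_iff) simp_all
      then have "real (k * l) < real (2 ^ L2)" by (simp add: powr_realpow)
      then have "k * l < 2 ^ L2" by (rule of_nat_less_imp_less)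
      then have "(k * l) ^ t < (2 ^ L2) ^ t" using 3 by (intro power_strict_mono) auto
      moreover have "(k * l) choose t \<le> (k * l) ^ t"
        by (cases "t \<le> k * l") (auto simp: binomial_le_pow binomial_eq_0)
      ultimately have s1: "(k * l) choose t < 2 ^ s" unfolding s_def by (simp add: power_mult[symmetric] mult.commute)
      have s2: "s \<ge> 1" unfolding s_def L2_def using 3 by simp
      have "real s \<le> real t * (log 2 (real k * real l) + 1)"
        unfolding s_def using L2(2) by (simp add: mult_left_mono)
      then have "64 * real s ^ 3 \<le> 64 * (real t * (log 2 (real k * real l) + 1)) ^ 3"
        by (intro mult_left_mono power_mono) auto
      then have s3: "R > 64 * real s ^ 3" using L by linarith
      show "card F \<le> card (canonical_family k l T) \<and>
        (card F = card (canonical_family k l T) \<longrightarrow>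
          (\<exists>S. S \<subseteq> {1..k * l} \<and> card S = t \<and> F = canonical_family k l S))"
        using L by (intro partially_t_intersecting_bound[OF F T 3 _ _ R _ s1 s2 s3 M_def q_def]) auto
    qed
  qed
qed

end
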